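(* Let $(x,u)$ be an optimal solution of the two-mode optimal control problem with time-varying switching interface $g(x,t)=0$ described in the context, crossing the interface exactly once, at time $\tau\in(t_0,t_f)$, and let $\lambda_1,\lambda_2$ be the associated co-states before and after the switch. Let $m^\top x+\mu t+c=0$ be the interface, or, if the interface is nonlinear, its tangent plane at the switching point $(x(\tau),\tau)$, so that $m=\frac{\partial g}{\partial x}(x(\tau),\tau)\in\mathbb{R}^n$ (column vector) and $\mu=\frac{\partial g}{\partial t}(x(\tau),\tau)\in\mathbb{R}$. With all quantities evaluated at the switching time along the optimal solution, put $$\Delta\lambda=\lambda_2(\tau)-\lambda_1(\tau),\quad \langle\lambda\rangle=\tfrac12(\lambda_2(\tau)+\lambda_1(\tau)),\quad \Delta f=f_2(\tau)-f_1(\tau),\quad \Delta L=L_2(\tau)-L_1(\tau),$$ $$\langle m^\top f+\mu\rangle=\tfrac12\left(m^\top f_1(\tau)+\mu\right)+\tfrac12\left(m^\top f_2(\tau)+\mu\right),$$ where $f_i(\tau)=f_i(x(\tau),u_i(\tau),\tau)$ and $L_i(\tau)=L_i(x(\tau),u_i(\tau),\tau)$. Then, provided $\langle m^\top f+\mu\rangle\neq0$, the co-state satisfies the jump law $$\Delta\lambda=-\frac{\left(\Delta L+\langle\lambda\rangle^\top\Delta f\right)m}{\langle m^\top f+\mu\rangle}.$$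
   Context: Problem. The state is $x(t)\in\mathbb{R}^n$ and the control is $u(t)$, valued in a finite-dimensional real space. The dynamics are $\dot x=f_1(x,u,t)$ if $g(x,t)\le 0$ and $\dot x=f_2(x,u,t)$ if $g(x,t)\ge 0$, where $g:\mathbb{R}^n\times\mathbb{R}\to\mathbb{R}$. The initial state $x(t_0)=x_0$, initial time $t_0$, and final time $t_f>t_0$ are given. The cost to be minimized is $J=\phi(x(t_f))+\int_{t_0}^{t_f}L\,dt$, where the stage cost is $L=L_1(x,u,t)$ if $g(x,t)\le 0$ and $L=L_2(x,u,t)$ if $g(x,t)\ge 0$, and $\phi$ is a terminal cost (possibly zero). The functions $f_i$, $L_i$, $\phi$, $g$ are continuously differentiable on their whole domains. The state is continuous at the interface (no state jumps), and the trajectory crosses the interface exactly once, from $g<0$ to $g>0$, at an unspecified time $\tau$, so $g(x(\tau),\tau)=0$. Notation. $x_1,u_1$ denote the restrictions of the solution to $[t_0,\tau]$ and $x_2,u_2$ those to $[\tau,t_f]$; $u_i$ is continuous up to $\tau$ (one-sided limits are used as values at $\tau$), $x_i$ is $C^1$, and $x_1(\tau)=x_2(\tau)=x(\tau)$. The mode Hamiltonians are $H_i(x,\lambda,u,t)=L_i(x,u,t)+\lambda^\top f_i(x,u,t)$. Associated co-states. These are $C^1$ functions $\lambda_1:[t_0,\tau]\to\mathbb{R}^n$ and $\lambda_2:[\tau,t_f]\to\mathbb{R}^n$ such that, together with a scalar Lagrange multiplier $\nu$, the augmented cost $$J_a=\phi(x_2(t_f))+\nu\, g(x(\tau),\tau)+\int_{t_0}^{\tau}\left[H_1(x_1,\lambda_1,u_1,t)-\lambda_1^\top\dot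 x_1\right]dt+\int_{\tau}^{t_f}\left[H_2(x_2,\lambda_2,u_2,t)-\lambda_2^\top\dot x_2\right]dt$$ is stationary at the optimal solution with respect to variations of $x_1,x_2,u_1,u_2,\tau$. That is, for $C^1$ one-parameter families $(x_1^\varepsilon,x_2^\varepsilon,u_1^\varepsilon,u_2^\varepsilon,\tau^\varepsilon)$ through the optimal solution at $\varepsilon=0$, with $x_1^\varepsilon(t_0)=x_0$, $x_2^\varepsilon(t_f)=x(t_f)$, and $x_1^\varepsilon(\tau^\varepsilon)=x_2^\varepsilon(\tau^\varepsilon)$, the derivative of $J_a$ at $\varepsilon=0$ is zero. Here $x_i,u_i,\lambda_i$ are extended slightly past $\tau$, with $x_i$ and $\lambda_i$ extended as $C^1$ functions and $u_i$ as continuous functions, so that varying $\tau$ makes sense; the families are not required to satisfy the state equations. *)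

theory Defs
  imports "HOL-Analysis.Analysis"
begin

section \<open>Continuous differentiability\<close>

definition cont_diff :: "('a::real_normed_vector \<Rightarrow> 'b::real_normed_vector) \<Rightarrow> bool" where
  "cont_diff F \<longleftrightarrow>
     (\<exists>F'. (\<forall>z. (F has_derivative blinfun_apply (F' z)) (at z)) \<and> continuous_on UNIV F')"

(* Unlike the library's C1_differentiable_on, derivatives are taken within S, so
   that they are one-sided at the end points of a compact interval. *)
definition C1_on :: "real set \<Rightarrow> (real \<Rightarrow> 'b::real_normed_vector) \<Rightarrow> bool" where
  "C1_on S F \<longleftrightarrow>
     (\<exists>D. (\<forall>t\<in>S. (F has_vector_derivative D t) (at t within S)) \<and> continuous_on S D)"

(* For S compact: e |-> F e is a C^1 curve, defined on the open set I, in the Banach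
   space C^0(S) of continuous functions on S. *)
definition C1_family_C0 :: "real set \<Rightarrow> real set \<Rightarrow> (real \<Rightarrow> real \<Rightarrow> 'b::real_normed_vector) \<Rightarrow> bool" where
  "C1_family_C0 I S F \<longleftrightarrow>
     continuous_on (I \<times> S) (\<lambda>(e, t). F e t) \<and>
     (\<exists>F'. (\<forall>e\<in>I. \<forall>t\<in>S. ((\<lambda>e. F e t) has_vector_derivative F' e t) (at e)) \<and>
           continuous_on (I \<times> S) (\<lambda>(e, t). F' e t))"

(* The same with C^1(S) in place of C^0(S). *)
definition C1_family_C1 :: "real set \<Rightarrow> real set \<Rightarrow> (real \<Rightarrow> real \<Rightarrow> 'b::real_normed_vector) \<Rightarrow> bool" where
  "C1_family_C1 I S F \<longleftrightarrow>
     C1_family_C0 I S F \<and>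
     (\<exists>G. (\<forall>e\<in>I. \<forall>t\<in>S. (F e has_vector_derivative G e t) (at t within S)) \<and>
          C1_family_C0 I S G)"


section \<open>One-sided restrictions of a control with a jump at the switching time\<close>

definition ctrl1 :: "(real \<Rightarrow> 'u::t2_space) \<Rightarrow> real \<Rightarrow> real \<Rightarrow> 'u" where
  "ctrl1 u \<tau> t = (if t = \<tau> then Lim (at_left \<tau>) u else u t)"

definition ctrl2 :: "(real \<Rightarrow> 'u::t2_space) \<Rightarrow> real \<Rightarrow> real \<Rightarrow> 'u" where
  "ctrl2 u \<tau> t = (if t = \<tau> then Lim (at_right \<tau>) u else u t)"


section \<open>The two-mode optimal control problem\<close>

locale two_mode_problem =
  fixes f1 f2 :: "real ^ 'n \<Rightarrow> 'u::euclidean_space \<Rightarrow> real \<Rightarrow> real ^ 'n"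
    and L1 L2 :: "real ^ 'n \<Rightarrow> 'u \<Rightarrow> real \<Rightarrow> real"
    and \<phi> :: "real ^ 'n \<Rightarrow> real"
    and g :: "real ^ 'n \<Rightarrow> real \<Rightarrow> real"
    and t0 tf :: real
    and x0 :: "real ^ 'n"
  assumes cont_diff_f1: "cont_diff (\<lambda>(x, u, t). f1 x u t)"
    and cont_diff_f2: "cont_diff (\<lambda>(x, u, t). f2 x u t)"
    and cont_diff_L1: "cont_diff (\<lambda>(x, u, t). L1 x u t)"
    and cont_diff_L2: "cont_diff (\<lambda>(x, u, t). L2 x u t)"
    and cont_diff_phi: "cont_diff \<phi>"
    and cont_diff_g: "cont_diff (\<lambda>(x, t). g x t)"
    and t0_less_tf: "t0 < tf"
begin

(* (x, u) satisfies the problem constraints and crosses the interface exactly once,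
   at time \<tau>, from g < 0 to g > 0.  The state equation is not imposed at \<tau>
   itself, where both modes are active and x has only one-sided derivatives; these
   satisfy the mode equations for the one-sided limits of u by continuity. *)
definition admissible :: "(real \<Rightarrow> real ^ 'n) \<Rightarrow> (real \<Rightarrow> 'u) \<Rightarrow> real \<Rightarrow> bool" where
  "admissible x u \<tau> \<longleftrightarrow>
     t0 < \<tau> \<and> \<tau> < tf \<and> x t0 = x0 \<and>
     C1_on {t0..\<tau>} x \<and> C1_on {\<tau>..tf} x \<and>
     continuous_on {t0..\<tau>} (ctrl1 u \<tau>) \<and>
     continuous_on {\<tau>..tf} (ctrl2 u \<tau>) \<and>
     (\<forall>t\<in>{t0..tf} - {\<tau>}.
        (g (x t) t \<le> 0 \<longrightarrow> (x has_vector_derivative f1 (x t) (u t) t) (at t within {t0..tf})) \<and>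
        (g (x t) t \<ge> 0 \<longrightarrow> (x has_vector_derivative f2 (x t) (u t) t) (at t within {t0..tf}))) \<and>
     (\<forall>t\<in>{t0..<\<tau>}. g (x t) t < 0) \<and> g (x \<tau>) \<tau> = 0 \<and> (\<forall>t\<in>{\<tau><..tf}. g (x t) t > 0)"

(* The value at g = 0 is immaterial: it concerns a single time. *)
definition stage_cost :: "real ^ 'n \<Rightarrow> 'u \<Rightarrow> real \<Rightarrow> real" where
  "stage_cost x u t = (if g x t \<le> 0 then L1 x u t else L2 x u t)"

definition cost :: "(real \<Rightarrow> real ^ 'n) \<Rightarrow> (real \<Rightarrow> 'u) \<Rightarrow> real" where
  "cost x u = \<phi> (x tf) + integral {t0..tf} (\<lambda>t. stage_cost (x t) (u t) t)"

definition optimal :: "(real \<Rightarrow> real ^ 'n) \<Rightarrow> (real \<Rightarrow> 'u) \<Rightarrow> real \<Rightarrow> bool" where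
  "optimal x u \<tau> \<longleftrightarrow>
     admissible x u \<tau> \<and> (\<forall>y v \<sigma>. admissible y v \<sigma> \<longrightarrow> cost x u \<le> cost y v)"

definition H1 :: "real ^ 'n \<Rightarrow> real ^ 'n \<Rightarrow> 'u \<Rightarrow> real \<Rightarrow> real" where
  "H1 x l u t = L1 x u t + l \<bullet> f1 x u t"

definition H2 :: "real ^ 'n \<Rightarrow> real ^ 'n \<Rightarrow> 'u \<Rightarrow> real \<Rightarrow> real" where
  "H2 x l u t = L2 x u t + l \<bullet> f2 x u t"

definition augmented_cost ::
    "real \<Rightarrow> (real \<Rightarrow> real ^ 'n) \<Rightarrow> (real \<Rightarrow> real ^ 'n) \<Rightarrow>
     (real \<Rightarrow> real ^ 'n) \<Rightarrow> (real \<Rightarrow> real ^ 'n) \<Rightarrow> (real \<Rightarrow> 'u) \<Rightarrow> (real \<Rightarrow> 'u) \<Rightarrow> real \<Rightarrow> real" where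
  "augmented_cost \<nu> l1 l2 x1 x2 u1 u2 T =
     \<phi> (x2 tf) + \<nu> * g (x1 T) T +
     integral {t0..T} (\<lambda>t. H1 (x1 t) (l1 t) (u1 t) t
        - l1 t \<bullet> vector_derivative x1 (at t within {t0..T})) +
     integral {T..tf} (\<lambda>t. H2 (x2 t) (l2 t) (u2 t) t
        - l2 t \<bullet> vector_derivative x2 (at t within {T..tf}))"

(* One-parameter families, indexed by e in (-r, r), through (x1, x2, u1, u2, \<tau>).
   Here x1, u1 live on [t0, \<tau> + d] and x2, u2 on [\<tau> - d, tf].  The families
   need not satisfy the state equations. *)
definition variation ::
    "real \<Rightarrow> (real \<Rightarrow> real ^ 'n) \<Rightarrow> (real \<Rightarrow> real ^ 'n) \<Rightarrow> (real \<Rightarrow> 'u) \<Rightarrow> (real \<Rightarrow> 'u) \<Rightarrow> real \<Rightarrow>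
     real \<Rightarrow> (real \<Rightarrow> real \<Rightarrow> real ^ 'n) \<Rightarrow> (real \<Rightarrow> real \<Rightarrow> real ^ 'n) \<Rightarrow>
     (real \<Rightarrow> real \<Rightarrow> 'u) \<Rightarrow> (real \<Rightarrow> real \<Rightarrow> 'u) \<Rightarrow> (real \<Rightarrow> real) \<Rightarrow> bool" where
  "variation d x1 x2 u1 u2 \<tau> r X1 X2 U1 U2 T \<longleftrightarrow>
     r > 0 \<and>
     C1_family_C1 {-r<..<r} {t0..\<tau> + d} X1 \<and> C1_family_C1 {-r<..<r} {\<tau> - d..tf} X2 \<and>
     C1_family_C0 {-r<..<r} {t0..\<tau> + d} U1 \<and> C1_family_C0 {-r<..<r} {\<tau> - d..tf} U2 \<and>
     C1_on {-r<..<r} T \<and> T ` {-r<..<r} \<subseteq> {\<tau> - d..\<tau> + d} \<and>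
     (\<forall>t\<in>{t0..\<tau> + d}. X1 0 t = x1 t \<and> U1 0 t = u1 t) \<and>
     (\<forall>t\<in>{\<tau> - d..tf}. X2 0 t = x2 t \<and> U2 0 t = u2 t) \<and> T 0 = \<tau> \<and>
     (\<forall>e\<in>{-r<..<r}. X1 e t0 = x0 \<and> X2 e tf = x2 tf \<and> X1 e (T e) = X2 e (T e))"

(* l1, l2 are co-states associated with the solution (x, u) switching at \<tau>.  All
   functions are extended by some d > 0 past \<tau>; stationarity depends only on their
   values on [t0, \<tau>] and [\<tau>, tf], so the choice of the extensions is immaterial. *)
definition costates ::
    "(real \<Rightarrow> real ^ 'n) \<Rightarrow> (real \<Rightarrow> 'u) \<Rightarrow> real \<Rightarrow> (real \<Rightarrow> real ^ 'n) \<Rightarrow> (real \<Rightarrow> real ^ 'n) \<Rightarrow> bool" where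
  "costates x u \<tau> l1 l2 \<longleftrightarrow>
     C1_on {t0..\<tau>} l1 \<and> C1_on {\<tau>..tf} l2 \<and>
     (\<exists>\<nu> d x1 x2 u1 u2 m1 m2.
        d > 0 \<and>
        C1_on {t0..\<tau> + d} x1 \<and> C1_on {\<tau> - d..tf} x2 \<and>
        continuous_on {t0..\<tau> + d} u1 \<and> continuous_on {\<tau> - d..tf} u2 \<and>
        C1_on {t0..\<tau> + d} m1 \<and> C1_on {\<tau> - d..tf} m2 \<and>
        (\<forall>t\<in>{t0..\<tau>}. x1 t = x t \<and> u1 t = ctrl1 u \<tau> t \<and> m1 t = l1 t) \<and>
        (\<forall>t\<in>{\<tau>..tf}. x2 t = x t \<and> u2 t = ctrl2 u \<tau> t \<and> m2 t = l2 t) \<and>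
        (\<forall>r X1 X2 U1 U2 T. variation d x1 x2 u1 u2 \<tau> r X1 X2 U1 U2 T \<longrightarrow>
           ((\<lambda>e. augmented_cost \<nu> m1 m2 (X1 e) (X2 e) (U1 e) (U2 e) (T e))
              has_real_derivative 0) (at 0)))"

end

end

theory Submission
  imports Defs
begin

text \<open>
  The jump law is what remains of the stationarity of the augmented cost when the variations are
  concentrated at the switching time.  Two kinds of variation are needed.

  \<^item> Keep the switching time and move the switching point by \<open>v\<close>.  The interface term changes by
    \<open>\<nu> * (m \<bullet> v)\<close> and integration by parts produces the boundary terms \<open>- (lam1 \<bullet> v)\<close> and \<open>lam2 \<bullet> v\<close>, so
    \<open>lam2 - lam1 = - (\<nu> *\<^sub>R m)\<close>.

  \<^item> Move the switching time with unit velocity and only prolong or shorten the first arc.  The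
    switching point then moves with velocity \<open>f1\<close>, so the second arc has to be corrected by
    \<open>f1 - f2\<close> at the switch.  On the trajectory the integrands at the switch are the stage costs, so
    \<open>\<nu> * (m \<bullet> f1 + \<mu>) = (L2 - L1) + lam2 \<bullet> (f2 - f1)\<close>.

  Writing \<open>lam2\<close> as the average of the co-states plus half their jump makes the second condition
  symmetric in the two modes; solving it for \<open>\<nu>\<close> and inserting this in the first gives the law.

  To concentrate them, the state variations are given the profile
  \<open>((t - a) / (\<tau> - a)) ^ Suc N\<close>, where \<open>a\<close> is the fixed end time of the arc.  As \<open>N\<close> tends to infinity,
  the integrals left over after integration by parts tend to zero, whatever the Hamiltonians are
  (lemma \<open>concentrating_weight_limit\<close>).  Both kinds of variation are instances of one family, for
  which \<open>switching_stationarity\<close> states the limit; the derivatives of its two integrals with moving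
  end points are \<open>first_variation_right_end\<close> and \<open>first_variation_left_end\<close>.
\<close>

section \<open>Integrals with a moving end point\<close>

lemma continuous_on_slice:
  assumes "continuous_on (I \<times> S) (\<lambda>(e, t). F e t)" "e \<in> I"
  shows "continuous_on S (F e)"
proof -
  have "continuous_on S (\<lambda>t. (\<lambda>(e, t). F e t) (e, t))"
    by (rule continuous_on_compose2[OF assms(1)]) (use assms(2) in \<open>auto intro!: continuous_intros\<close>)
  then show ?thesis by simp
qed

lemma endpoint_eventually_inside:
  fixes T :: "real \<Rightarrow> real"
  assumes "(T has_real_derivative T') (at z)" "a < T z" "T z < b"
  shows "\<forall>\<^sub>F e in nhds z. a < T e \<and> T e < b"
proof -
  have "(T \<longlongrightarrow> T z) (at z)"
    using DERIV_isCont[OF assms(1)] by (simp add: isCont_def)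
  from order_tendstoD[OF this] assms(2,3)
  have "\<forall>\<^sub>F e in at z. a < T e \<and> T e < b" by (simp add: eventually_conj)
  with assms(2,3) show ?thesis by (simp add: eventually_nhds_conv_at)
qed

text \<open>
  As a function of the parameter and the upper limit separately, the integral is partially
  differentiable, by the Leibniz rule and the fundamental theorem of calculus, and the second
  partial derivative is jointly continuous.  Hence it is totally differentiable at the base
  point, and the chain rule along the curve \<open>e \<mapsto> (e, T e)\<close> gives the formula.
\<close>

lemma moving_endpoint_derivative:
  fixes \<Phi> \<Phi>' :: "real \<Rightarrow> real \<Rightarrow> real"
  assumes r: "r > 0" and s: "a < s" "s < b"
    and cont: "continuous_on ({-r<..<r} \<times> {a..b}) (\<lambda>(e, t). \<Phi> e t)"
    and cont': "continuous_on ({-r<..<r} \<times> {a..b}) (\<lambda>(e, t). \<Phi>' e t)"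
    and deriv: "\<And>e t. e \<in> {-r<..<r} \<Longrightarrow> t \<in> {a..b} \<Longrightarrow>
        ((\<lambda>e. \<Phi> e t) has_real_derivative \<Phi>' e t) (at e)"
    and T: "(T has_real_derivative T') (at 0)" "T 0 = s"
  shows "((\<lambda>e. integral {a..T e} (\<Phi> e)) has_real_derivative
      (\<Phi> 0 s * T' + integral {a..s} (\<Phi>' 0))) (at 0)"
proof -
  let ?X = "{-r<..<r}" and ?Y = "{a..b}"
  define J where "J e z = integral {a..z} (\<Phi> e)" for e z
  note cont_slice = continuous_on_slice[OF cont]
  have "((\<lambda>e. integral (cbox a s) (\<Phi> e)) has_field_derivative integral (cbox a s) (\<Phi>' 0))
      (at 0 within ?X)"
  proof (rule leibniz_rule_field_derivative)
    show "((\<lambda>e. \<Phi> e t) has_real_derivative \<Phi>' e t) (at e within ?X)"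
      if "e \<in> ?X" "t \<in> cbox a s" for e t
      using deriv[of e t] that s by (auto intro: has_field_derivative_at_within)
    show "\<Phi> e integrable_on cbox a s" if "e \<in> ?X" for e
      using continuous_on_subset[OF cont_slice[OF that], of "{a..s}"] s
      by (auto intro!: integrable_continuous_real)
    show "continuous_on (?X \<times> cbox a s) (\<lambda>(e, t). \<Phi>' e t)"
      by (rule continuous_on_subset[OF cont']) (use s in auto)
  qed (use r in auto)
  then have fx: "((\<lambda>e. J e s) has_derivative (*) (integral {a..s} (\<Phi>' 0))) (at 0 within ?X)"
    by (simp add: J_def has_field_derivative_def)
  have fy: "((\<lambda>z. J e z) has_derivative blinfun_apply (blinfun_mult_right (\<Phi> e z))) (at z within ?Y)"
    if "e \<in> ?X" "z \<in> ?Y" for e z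
    using integral_has_real_derivative[OF cont_slice[OF that(1)] that(2)]
    by (simp add: J_def has_field_derivative_def)
  have "((\<lambda>(e, z). J e z) has_derivative
      (\<lambda>(h, k). integral {a..s} (\<Phi>' 0) * h + blinfun_apply (blinfun_mult_right (\<Phi> 0 s)) k))
      (at (0, s) within ?X \<times> ?Y)"
  proof (rule has_derivative_partialsI)
    show "((\<lambda>e. J e s) has_derivative (*) (integral {a..s} (\<Phi>' 0))) (at 0 within ?X)"
      by (rule fx)
    show "((\<lambda>z. J e z) has_derivative blinfun_apply (blinfun_mult_right (\<Phi> e z))) (at z within ?Y)"
      if "e \<in> ?X" "z \<in> ?Y" for e z using fy that .
    have "continuous_on (?X \<times> ?Y) (\<lambda>(e, z). blinfun_mult_right (\<Phi> e z))"
      using cont unfolding split_beta by (intro continuous_intros)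
    then show "continuous (at (0, s) within ?X \<times> ?Y) (\<lambda>(e, z). blinfun_mult_right (\<Phi> e z))"
      using r s by (auto simp: continuous_on_eq_continuous_within)
  qed (use s in auto)
  moreover have "at (0, s) within ?X \<times> ?Y = at (0, T 0)"
    unfolding T(2) by (rule at_within_interior) (use r s in \<open>simp add: interior_Times\<close>)
  ultimately have J: "((\<lambda>(e, z). J e z) has_derivative
      (\<lambda>(h, k). integral {a..s} (\<Phi>' 0) * h + \<Phi> 0 s * k)) (at (0, T 0))"
    by simp
  have "((\<lambda>e. (e, T e)) has_derivative (\<lambda>h. (h, T' * h))) (at 0)"
    using has_derivative_Pair[OF has_derivative_ident T(1)[unfolded has_field_derivative_def]] .
  from has_derivative_compose[OF this J]
  have "((\<lambda>e. integral {a..T e} (\<Phi> e)) has_derivative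
      (\<lambda>h. integral {a..s} (\<Phi>' 0) * h + \<Phi> 0 s * (T' * h))) (at 0)"
    by (simp add: J_def)
  then show ?thesis
    unfolding has_field_derivative_def by (rule has_derivative_eq_rhs) (auto simp: algebra_simps)
qed

lemma moving_left_endpoint_derivative:
  fixes \<Phi> \<Phi>' :: "real \<Rightarrow> real \<Rightarrow> real"
  assumes r: "r > 0" and s: "a < s" "s < b"
    and cont: "continuous_on ({-r<..<r} \<times> {a..b}) (\<lambda>(e, t). \<Phi> e t)"
    and cont': "continuous_on ({-r<..<r} \<times> {a..b}) (\<lambda>(e, t). \<Phi>' e t)"
    and deriv: "\<And>e t. e \<in> {-r<..<r} \<Longrightarrow> t \<in> {a..b} \<Longrightarrow>
        ((\<lambda>e. \<Phi> e t) has_real_derivative \<Phi>' e t) (at e)"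
    and T: "(T has_real_derivative T') (at 0)" "T 0 = s"
  shows "((\<lambda>e. integral {T e..b} (\<Phi> e)) has_real_derivative
      (integral {s..b} (\<Phi>' 0) - \<Phi> 0 s * T')) (at 0)"
proof -
  let ?X = "{-r<..<r}"
  note slice = continuous_on_slice[OF cont] continuous_on_slice[OF cont']
  have "((\<lambda>e. integral (cbox a b) (\<Phi> e)) has_field_derivative integral (cbox a b) (\<Phi>' 0))
      (at 0 within ?X)"
    by (rule leibniz_rule_field_derivative)
      (use deriv cont' slice r in \<open>auto intro: has_field_derivative_at_within integrable_continuous_real\<close>)
  then have whole: "((\<lambda>e. integral {a..b} (\<Phi> e)) has_real_derivative integral {a..b} (\<Phi>' 0)) (at 0)"
    using r by (simp add: at_within_open[of _ ?X])
  have "integral {a..s} (\<Phi>' 0) + integral {s..b} (\<Phi>' 0) = integral {a..b} (\<Phi>' 0)"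
    by (rule Henstock_Kurzweil_Integration.integral_combine)
      (use s slice(2)[of 0] r in \<open>auto intro: integrable_continuous_real\<close>)
  then have "integral {a..b} (\<Phi>' 0) - (\<Phi> 0 s * T' + integral {a..s} (\<Phi>' 0))
      = integral {s..b} (\<Phi>' 0) - \<Phi> 0 s * T'"
    by simp
  with DERIV_diff[OF whole moving_endpoint_derivative[OF assms]]
  have D: "((\<lambda>e. integral {a..b} (\<Phi> e) - integral {a..T e} (\<Phi> e)) has_real_derivative
      (integral {s..b} (\<Phi>' 0) - \<Phi> 0 s * T')) (at 0)"
    by (simp only:)
  have ev: "\<forall>\<^sub>F e in nhds 0. integral {a..b} (\<Phi> e) - integral {a..T e} (\<Phi> e)
      = integral {T e..b} (\<Phi> e)"
  proof -
    have "\<forall>\<^sub>F e in nhds 0. a < T e \<and> T e < b"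
      using endpoint_eventually_inside[OF T(1)] s T(2) by simp
    moreover have "\<forall>\<^sub>F e in nhds 0. e \<in> ?X"
      using r by (intro eventually_nhds_in_open) auto
    ultimately show ?thesis
    proof eventually_elim
      case (elim e)
      then show ?case
        using Henstock_Kurzweil_Integration.integral_combine[of a "T e" b "\<Phi> e"] slice[of e]
        by (simp add: integrable_continuous_real algebra_simps)
    qed
  qed
  show ?thesis
    using D by (rule DERIV_cong_ev[OF refl ev refl, THEN iffD1])
qed

section \<open>Variations concentrated at the switching time\<close>

text \<open>
  This replaces the fundamental lemma of the calculus of variations.  Integrating \<open>q * p'\<close> by
  parts leaves the boundary terms and an integral against \<open>p N\<close>, which vanishes in the limit
  by dominated convergence.  Only what the weights do at the end points survives.
\<close>

lemma concentrating_weight_limit: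
  fixes p p' :: "nat \<Rightarrow> real \<Rightarrow> real" and k q q' :: "real \<Rightarrow> real"
  assumes ab: "a \<le> b"
    and k: "continuous_on {a..b} k" and q': "continuous_on {a..b} q'"
    and q: "\<And>t. t \<in> {a..b} \<Longrightarrow> (q has_vector_derivative q' t) (at t within {a..b})"
    and p': "\<And>N. continuous_on {a..b} (p' N)"
    and p: "\<And>N t. t \<in> {a..b} \<Longrightarrow> (p N has_vector_derivative p' N t) (at t within {a..b})"
    and p_bound: "\<And>N t. t \<in> {a..b} \<Longrightarrow> \<bar>p N t\<bar> \<le> 1"
    and p_lim: "\<And>t. t \<in> {a<..<b} \<Longrightarrow> (\<lambda>N. p N t) \<longlonglongrightarrow> 0"
    and p_ends: "\<And>N. p N a = \<alpha>" "\<And>N. p N b = \<beta>"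
  shows "(\<lambda>N. integral {a..b} (\<lambda>t. k t * p N t - q t * p' N t)) \<longlonglongrightarrow> q a * \<alpha> - q b * \<beta>"
proof -
  have cont_p: "continuous_on {a..b} (p N)" for N
    using p by (rule continuous_on_vector_derivative)
  have cont_q: "continuous_on {a..b} q"
    using q by (rule continuous_on_vector_derivative)
  have cont_kq: "continuous_on {a..b} (\<lambda>t. k t + q' t)"
    using k q' by (intro continuous_intros)
  have parts: "integral {a..b} (\<lambda>t. k t * p N t - q t * p' N t)
      = integral {a..b} (\<lambda>t. (k t + q' t) * p N t) - (q b * \<beta> - q a * \<alpha>)" for N
  proof -
    have "((\<lambda>t. q t * p' N t + q' t * p N t) has_integral (q b * p N b - q a * p N a)) {a..b}"
      by (rule fundamental_theorem_of_calculus[OF ab])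
        (auto intro!: has_vector_derivative_mult q p)
    moreover have "(\<lambda>t. (k t + q' t) * p N t) integrable_on {a..b}"
      by (intro integrable_continuous_real continuous_intros cont_kq cont_p)
    ultimately have "((\<lambda>t. (k t + q' t) * p N t - (q t * p' N t + q' t * p N t)) has_integral
        (integral {a..b} (\<lambda>t. (k t + q' t) * p N t) - (q b * \<beta> - q a * \<alpha>))) {a..b}"
      unfolding p_ends by (intro has_integral_diff) (auto simp: integrable_integral)
    then have "((\<lambda>t. k t * p N t - q t * p' N t) has_integral
        (integral {a..b} (\<lambda>t. (k t + q' t) * p N t) - (q b * \<beta> - q a * \<alpha>))) {a..b}"
      by (simp add: algebra_simps)
    then show ?thesis by (rule integral_unique)
  qed
  define limit where "limit t = (if t = a then (k a + q' a) * \<alpha> else if t = b then (k b + q' b) * \<beta> else 0)"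
    for t
  have "(\<lambda>N. integral {a..b} (\<lambda>t. (k t + q' t) * p N t)) \<longlonglongrightarrow> integral {a..b} limit"
  proof (rule dominated_convergence(2))
    show "(\<lambda>t. (k t + q' t) * p N t) integrable_on {a..b}" for N
      by (intro integrable_continuous_real continuous_intros cont_kq cont_p)
    show "(\<lambda>t. \<bar>k t + q' t\<bar>) integrable_on {a..b}"
      by (intro integrable_continuous_real continuous_intros cont_kq)
    show "norm ((k t + q' t) * p N t) \<le> \<bar>k t + q' t\<bar>" if "t \<in> {a..b}" for N t
      using mult_left_mono[OF p_bound[OF that, of N] abs_ge_zero[of "k t + q' t"]] by (simp add: abs_mult)
    show "(\<lambda>N. (k t + q' t) * p N t) \<longlonglongrightarrow> limit t" if "t \<in> {a..b}" for t
      using tendsto_mult_right_zero[OF p_lim, of t "k t + q' t"] that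
      by (auto simp: limit_def p_ends)
  qed
  moreover have "(limit has_integral 0) {a..b}"
    by (rule has_integral_spike_finite[where S = "{a, b}" and f = "\<lambda>_. 0"]) (auto simp: limit_def)
  ultimately have "(\<lambda>N. integral {a..b} (\<lambda>t. (k t + q' t) * p N t)) \<longlonglongrightarrow> 0"
    by (simp add: integral_unique)
  from tendsto_diff[OF this tendsto_const[of "q b * \<beta> - q a * \<alpha>"]]
  show ?thesis by (simp add: parts)
qed

text \<open>
  A weight that is \<open>0\<close> at \<open>\<sigma>\<close> and \<open>1\<close> at \<open>\<rho>\<close>, on either side of \<open>\<sigma>\<close>: with \<open>\<rho>\<close> the switching time
  and \<open>\<sigma>\<close> the initial or final time, it respects the fixed end points and concentrates at the
  switch as \<open>N\<close> grows.  The exponent is \<open>Suc N\<close> so that it vanishes at \<open>\<sigma>\<close> also for \<open>N = 0\<close>.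
\<close>

definition weight :: "real \<Rightarrow> real \<Rightarrow> nat \<Rightarrow> real \<Rightarrow> real" where
  "weight \<sigma> \<rho> N t = ((t - \<sigma>) / (\<rho> - \<sigma>)) ^ Suc N"

definition weight' :: "real \<Rightarrow> real \<Rightarrow> nat \<Rightarrow> real \<Rightarrow> real" where
  "weight' \<sigma> \<rho> N t = real (Suc N) * ((t - \<sigma>) / (\<rho> - \<sigma>)) ^ N / (\<rho> - \<sigma>)"

lemma weight_ends: "weight \<sigma> \<rho> N \<sigma> = 0" "\<sigma> \<noteq> \<rho> \<Longrightarrow> weight \<sigma> \<rho> N \<rho> = 1"
  by (simp_all add: weight_def)

lemma weight_nonzero: "\<sigma> \<noteq> \<rho> \<Longrightarrow> t \<noteq> \<sigma> \<Longrightarrow> weight \<sigma> \<rho> N t \<noteq> 0"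
  by (simp add: weight_def)

lemma weight_deriv: "(weight \<sigma> \<rho> N has_real_derivative weight' \<sigma> \<rho> N t) (at t within S)"
proof -
  have "((\<lambda>t. (t - \<sigma>) / (\<rho> - \<sigma>)) has_real_derivative (1 - 0) / (\<rho> - \<sigma>)) (at t within S)"
    by (intro DERIV_cdivide DERIV_diff DERIV_ident DERIV_const)
  from DERIV_power_Suc[OF this, of N] show ?thesis
    unfolding weight_def[abs_def] weight'_def by (simp add: algebra_simps)
qed

lemma continuous_on_weight: "continuous_on S (weight \<sigma> \<rho> N)"
  unfolding weight_def[abs_def] divide_inverse by (intro continuous_intros)

lemma continuous_on_weight': "continuous_on S (weight' \<sigma> \<rho> N)"
  unfolding weight'_def[abs_def] divide_inverse by (intro continuous_intros)

lemma weight_base_range: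
  fixes \<sigma> \<rho> t :: real
  shows "t \<in> closed_segment \<sigma> \<rho> \<Longrightarrow> \<bar>(t - \<sigma>) / (\<rho> - \<sigma>)\<bar> \<le> 1"
    and "t \<in> open_segment \<sigma> \<rho> \<Longrightarrow> \<bar>(t - \<sigma>) / (\<rho> - \<sigma>)\<bar> < 1"
  by (auto simp: closed_segment_eq_real_ivl open_segment_eq_real_ivl abs_divide divide_simps split: if_splits)

lemma weight_bound: "t \<in> closed_segment \<sigma> \<rho> \<Longrightarrow> \<bar>weight \<sigma> \<rho> N t\<bar> \<le> 1"
  unfolding weight_def power_abs by (rule power_le_one) (use weight_base_range in auto)

lemma weight_lim: "t \<in> open_segment \<sigma> \<rho> \<Longrightarrow> (\<lambda>N. weight \<sigma> \<rho> N t) \<longlonglongrightarrow> 0"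
  unfolding weight_def by (rule LIMSEQ_Suc, rule LIMSEQ_power_zero) (use weight_base_range in simp)

section \<open>First variation of one arc of the augmented cost\<close>

lemma cont_diff_continuous_on: "cont_diff F \<Longrightarrow> continuous_on S F"
  unfolding cont_diff_def
  by (elim exE conjE) (rule has_derivative_continuous_on, rule has_derivative_at_withinI, erule spec)

text \<open>
  Along a fixed control and co-state, all that matters about a mode is its Hamiltonian as a
  function of state and time.  Its state derivative is kept as a function of the direction,
  jointly continuous in all three arguments; linearity in the direction is implied.
\<close>

lemma state_derivative_of_hamiltonian:
  fixes L :: "'x::real_inner \<Rightarrow> 'u::real_normed_vector \<Rightarrow> real \<Rightarrow> real"
    and f :: "'x \<Rightarrow> 'u \<Rightarrow> real \<Rightarrow> 'x"
  assumes L: "cont_diff (\<lambda>(x, u, t). L x u t)" and f: "cont_diff (\<lambda>(x, u, t). f x u t)"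
    and u: "continuous_on S u" and l: "continuous_on S l"
  obtains h' where
    "\<And>x t. ((\<lambda>x. L x (u t) t + l t \<bullet> f x (u t) t) has_derivative h' x t) (at x)"
    "continuous_on (UNIV \<times> S \<times> UNIV) (\<lambda>(x, t, v). h' x t v)"
    "continuous_on (UNIV \<times> S) (\<lambda>(x, t). L x (u t) t + l t \<bullet> f x (u t) t)"
proof -
  obtain L' where L': "\<And>z. ((\<lambda>(x, u, t). L x u t) has_derivative blinfun_apply (L' z)) (at z)"
    and L'_cont: "continuous_on UNIV L'"
    using L unfolding cont_diff_def by blast
  obtain f' where f': "\<And>z. ((\<lambda>(x, u, t). f x u t) has_derivative blinfun_apply (f' z)) (at z)"
    and f'_cont: "continuous_on UNIV f'"
    using f unfolding cont_diff_def by blast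
  have L_cont: "continuous_on UNIV (\<lambda>(x, u, t). L x u t)"
    by (rule cont_diff_continuous_on[OF L])
  have f_cont: "continuous_on UNIV (\<lambda>(x, u, t). f x u t)"
    by (rule cont_diff_continuous_on[OF f])
  define h' where "h' x t v = L' (x, u t, t) (v, 0, 0) + l t \<bullet> f' (x, u t, t) (v, 0, 0)" for x t v
  show ?thesis
  proof
    fix x :: 'x and t :: real
    have emb: "((\<lambda>x. (x, u t, t)) has_derivative (\<lambda>v. (v, 0, 0))) (at x)"
      using has_derivative_Pair[OF has_derivative_ident has_derivative_const[of "(u t, t)"]]
      by (simp add: zero_prod_def)
    show "((\<lambda>x. L x (u t) t + l t \<bullet> f x (u t) t) has_derivative h' x t) (at x)"
      unfolding h'_def
      using has_derivative_compose[OF emb L'] has_derivative_compose[OF emb f']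
      by (auto intro!: has_derivative_add has_derivative_inner_right)
  next
    have uz: "continuous_on (UNIV \<times> S \<times> UNIV) (\<lambda>z. u (fst (snd z)))"
      by (rule continuous_on_compose2[OF u]) (auto intro!: continuous_intros)
    have lz: "continuous_on (UNIV \<times> S \<times> UNIV) (\<lambda>z. l (fst (snd z)))"
      by (rule continuous_on_compose2[OF l]) (auto intro!: continuous_intros)
    show "continuous_on (UNIV \<times> S \<times> UNIV) (\<lambda>(x, t, v). h' x t v)"
      unfolding h'_def split_beta
      by (intro continuous_intros lz uz continuous_on_compose2[OF L'_cont] continuous_on_compose2[OF f'_cont]) auto
  next
    have uz: "continuous_on (UNIV \<times> S) (\<lambda>z. u (snd z))"
      by (rule continuous_on_compose2[OF u]) (auto intro!: continuous_intros)
    have lz: "continuous_on (UNIV \<times> S) (\<lambda>z. l (snd z))"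
      by (rule continuous_on_compose2[OF l]) (auto intro!: continuous_intros)
    have pt: "continuous_on (UNIV \<times> S) (\<lambda>z. (fst z, u (snd z), snd z))"
      by (intro continuous_intros uz)
    have "continuous_on (UNIV \<times> S) (\<lambda>z. L (fst z) (u (snd z)) (snd z))"
      using continuous_on_compose2[OF L_cont pt] by simp
    moreover have "continuous_on (UNIV \<times> S) (\<lambda>z. f (fst z) (u (snd z)) (snd z))"
      using continuous_on_compose2[OF f_cont pt] by simp
    ultimately show "continuous_on (UNIV \<times> S) (\<lambda>(x, t). L x (u t) t + l t \<bullet> f x (u t) t)"
      unfolding split_beta by (intro continuous_intros lz)
  qed
qed

lemma C1_family_C0_scaled:
  fixes y :: "real \<Rightarrow> 'b::real_normed_vector"
  assumes y: "continuous_on S y" and p: "continuous_on S p"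
    and c: "\<And>e. e \<in> I \<Longrightarrow> (c has_vector_derivative c' e) (at e)" and c': "continuous_on I c'"
  shows "C1_family_C0 I S (\<lambda>e t. y t + p t *\<^sub>R c e)"
proof -
  have ys: "continuous_on (I \<times> S) (\<lambda>z. y (snd z))"
    by (rule continuous_on_compose2[OF y]) (auto intro!: continuous_intros)
  have ps: "continuous_on (I \<times> S) (\<lambda>z. p (snd z))"
    by (rule continuous_on_compose2[OF p]) (auto intro!: continuous_intros)
  have "continuous_on I c"
    by (rule continuous_on_vector_derivative) (rule has_vector_derivative_at_within, rule c)
  then have cf: "continuous_on (I \<times> S) (\<lambda>z. c (fst z))"
    by (rule continuous_on_compose2) (auto intro!: continuous_intros)
  have cf': "continuous_on (I \<times> S) (\<lambda>z. c' (fst z))"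
    by (rule continuous_on_compose2[OF c']) (auto intro!: continuous_intros)
  have "((\<lambda>e. y t + p t *\<^sub>R c e) has_vector_derivative p t *\<^sub>R c' e) (at e)" if "e \<in> I" for e t
    using has_vector_derivative_add[OF has_vector_derivative_const
        bounded_linear.has_vector_derivative[OF bounded_linear_scaleR_right c[OF that]]] by simp
  moreover have "continuous_on (I \<times> S) (\<lambda>(e, t). p t *\<^sub>R c' e)"
    unfolding split_beta by (intro continuous_intros ps cf')
  moreover have "continuous_on (I \<times> S) (\<lambda>(e, t). y t + p t *\<^sub>R c e)"
    unfolding split_beta by (intro continuous_intros ys ps cf)
  ultimately show ?thesis
    unfolding C1_family_C0_def by (intro conjI exI[of _ "\<lambda>e t. p t *\<^sub>R c' e"]) auto
qed

text \<open>
  One arc of the trajectory, before or after the switch: \<open>h\<close> is the Hamiltonian of its mode along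
  the control and the co-state, \<open>y\<close> the state and \<open>l\<close> the co-state, on the interval to which they
  are extended past the switching time.
\<close>

locale mode_arc =
  fixes a b :: real
    and h :: "'a::euclidean_space \<Rightarrow> real \<Rightarrow> real" and h' :: "'a \<Rightarrow> real \<Rightarrow> 'a \<Rightarrow> real"
    and y Dy l Dl :: "real \<Rightarrow> 'a"
  assumes h_deriv: "\<And>x t. ((\<lambda>x. h x t) has_derivative h' x t) (at x)"
    and h_cont: "continuous_on (UNIV \<times> {a..b}) (\<lambda>(x, t). h x t)"
    and h'_cont: "continuous_on (UNIV \<times> {a..b} \<times> UNIV) (\<lambda>(x, t, v). h' x t v)"
    and y_deriv: "\<And>t. t \<in> {a..b} \<Longrightarrow> (y has_vector_derivative Dy t) (at t within {a..b})"
    and Dy_cont: "continuous_on {a..b} Dy"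
    and l_deriv: "\<And>t. t \<in> {a..b} \<Longrightarrow> (l has_vector_derivative Dl t) (at t within {a..b})"
    and Dl_cont: "continuous_on {a..b} Dl"
begin

lemma y_cont: "continuous_on {a..b} y"
  using y_deriv by (rule continuous_on_vector_derivative)

lemma l_cont: "continuous_on {a..b} l"
  using l_deriv by (rule continuous_on_vector_derivative)

lemma h'_scaleR: "h' x t (k *\<^sub>R v) = k * h' x t v"
  using linear_scale[OF has_derivative_linear[OF h_deriv]] by simp

lemma h'_along_y_cont: "continuous_on {a..b} (\<lambda>t. h' (y t) t v)"
proof -
  have "continuous_on {a..b} (\<lambda>t. (y t, t, v))"
    by (intro continuous_intros y_cont)
  from continuous_on_compose2[OF h'_cont this] show ?thesis by auto
qed

text \<open>
  A variation concentrated at the switching time \<open>s\<close> integrates the state derivative of the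
  Hamiltonian against a weight that tends to zero on the arc.  So the first variation retains
  only the boundary term of the co-state, here and for the other arc in the next lemma.
\<close>

lemma limit_at_right_end:
  assumes "a < s" "s \<le> b"
  shows "(\<lambda>N. integral {a..s} (\<lambda>t. h' (y t) t v * weight a s N t - (l t \<bullet> v) * weight' a s N t))
    \<longlonglongrightarrow> - (l s \<bullet> v)"
proof -
  have sub: "{a..s} \<subseteq> {a..b}" using assms by auto
  have "(\<lambda>N. integral {a..s} (\<lambda>t. h' (y t) t v * weight a s N t - (l t \<bullet> v) * weight' a s N t))
    \<longlonglongrightarrow> (l a \<bullet> v) * 0 - (l s \<bullet> v) * 1"
  proof (rule concentrating_weight_limit)
    show "continuous_on {a..s} (\<lambda>t. h' (y t) t v)"
      by (rule continuous_on_subset[OF h'_along_y_cont sub])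
    show "continuous_on {a..s} (\<lambda>t. Dl t \<bullet> v)"
      by (intro continuous_intros continuous_on_subset[OF Dl_cont sub])
    show "((\<lambda>t. l t \<bullet> v) has_vector_derivative Dl t \<bullet> v) (at t within {a..s})" if "t \<in> {a..s}" for t
      using bounded_linear.has_vector_derivative[OF bounded_linear_inner_left
          has_vector_derivative_within_subset[OF l_deriv sub]] that sub by auto
    show "(weight a s N has_vector_derivative weight' a s N t) (at t within {a..s})" for N t
      using weight_deriv by (simp add: has_real_derivative_iff_has_vector_derivative)
  qed (use assms in \<open>auto simp: weight_ends continuous_on_weight' closed_segment_eq_real_ivl
      open_segment_eq_real_ivl intro!: weight_bound weight_lim\<close>)
  then show ?thesis by simp
qed

lemma limit_at_left_end:
  assumes "a \<le> s" "s < b"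
  shows "(\<lambda>N. integral {s..b} (\<lambda>t. h' (y t) t v * weight b s N t - (l t \<bullet> v) * weight' b s N t))
    \<longlonglongrightarrow> l s \<bullet> v"
proof -
  have sub: "{s..b} \<subseteq> {a..b}" using assms by auto
  have "(\<lambda>N. integral {s..b} (\<lambda>t. h' (y t) t v * weight b s N t - (l t \<bullet> v) * weight' b s N t))
    \<longlonglongrightarrow> (l s \<bullet> v) * 1 - (l b \<bullet> v) * 0"
  proof (rule concentrating_weight_limit)
    show "continuous_on {s..b} (\<lambda>t. h' (y t) t v)"
      by (rule continuous_on_subset[OF h'_along_y_cont sub])
    show "continuous_on {s..b} (\<lambda>t. Dl t \<bullet> v)"
      by (intro continuous_intros continuous_on_subset[OF Dl_cont sub])
    show "((\<lambda>t. l t \<bullet> v) has_vector_derivative Dl t \<bullet> v) (at t within {s..b})" if "t \<in> {s..b}" for t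
      using bounded_linear.has_vector_derivative[OF bounded_linear_inner_left
          has_vector_derivative_within_subset[OF l_deriv sub]] that sub by auto
    show "(weight b s N has_vector_derivative weight' b s N t) (at t within {s..b})" for N t
      using weight_deriv by (simp add: has_real_derivative_iff_has_vector_derivative)
  qed (use assms in \<open>auto simp: weight_ends continuous_on_weight' closed_segment_eq_real_ivl
      open_segment_eq_real_ivl intro!: weight_bound weight_lim\<close>)
  then show ?thesis by simp
qed

end

text \<open>
  The state is varied by a fixed scalar profile \<open>p\<close> times a vector amplitude \<open>c\<close>, a curve in
  the variation parameter.  The amplitude has to be allowed to depend nonlinearly on the
  parameter, since the two arcs must still meet when the switching time moves.
\<close>

locale varied_arc = mode_arc a b h h' y Dy l Dl
  for a b :: real
    and h :: "'a::euclidean_space \<Rightarrow> real \<Rightarrow> real" and h' :: "'a \<Rightarrow> real \<Rightarrow> 'a \<Rightarrow> real"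
    and y Dy l Dl :: "real \<Rightarrow> 'a" +
  fixes p p' :: "real \<Rightarrow> real" and r :: real and c c' :: "real \<Rightarrow> 'a"
  assumes p_deriv: "\<And>t. t \<in> {a..b} \<Longrightarrow> (p has_vector_derivative p' t) (at t within {a..b})"
    and p'_cont: "continuous_on {a..b} p'"
    and r_pos: "r > 0"
    and c_deriv: "\<And>e. e \<in> {-r<..<r} \<Longrightarrow> (c has_vector_derivative c' e) (at e)"
    and c'_cont: "continuous_on {-r<..<r} c'"
    and c_0: "c 0 = 0"
begin

definition varied_state :: "real \<Rightarrow> real \<Rightarrow> 'a" where
  "varied_state e t = y t + p t *\<^sub>R c e"

definition lagrangian :: "real \<Rightarrow> real \<Rightarrow> real" where
  "lagrangian e t = h (varied_state e t) t - l t \<bullet> (Dy t + p' t *\<^sub>R c e)"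

definition lagrangian' :: "real \<Rightarrow> real \<Rightarrow> real" where
  "lagrangian' e t = h' (varied_state e t) t (p t *\<^sub>R c' e) - l t \<bullet> (p' t *\<^sub>R c' e)"

lemma p_cont: "continuous_on {a..b} p"
  using p_deriv by (rule continuous_on_vector_derivative)

lemma c_cont: "continuous_on {-r<..<r} c"
  by (rule continuous_on_vector_derivative) (rule has_vector_derivative_at_within, rule c_deriv)

lemma varied_state_deriv:
  assumes "t \<in> {a..b}"
  shows "(varied_state e has_vector_derivative Dy t + p' t *\<^sub>R c e) (at t within {a..b})"
proof -
  have "((\<lambda>t. p t *\<^sub>R c e) has_vector_derivative p' t *\<^sub>R c e) (at t within {a..b})"
    using bounded_linear.has_vector_derivative[OF bounded_linear_scaleR_left p_deriv[OF assms]] .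
  then show ?thesis
    unfolding varied_state_def[abs_def] by (intro has_vector_derivative_add y_deriv assms)
qed

lemma varied_state_family: "C1_family_C1 {-r<..<r} {a..b} varied_state"
proof -
  have "C1_family_C0 {-r<..<r} {a..b} (\<lambda>e t. y t + p t *\<^sub>R c e)"
    by (rule C1_family_C0_scaled[OF y_cont p_cont c_deriv c'_cont])
  moreover have "C1_family_C0 {-r<..<r} {a..b} (\<lambda>e t. Dy t + p' t *\<^sub>R c e)"
    by (rule C1_family_C0_scaled[OF Dy_cont p'_cont c_deriv c'_cont])
  ultimately show ?thesis
    using varied_state_deriv unfolding C1_family_C1_def varied_state_def[abs_def]
    by (intro conjI exI[of _ "\<lambda>e t. Dy t + p' t *\<^sub>R c e"]) auto
qed

lemma lagrangian_cont:
  "continuous_on ({-r<..<r} \<times> {a..b}) (\<lambda>(e, t). lagrangian e t)"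
  "continuous_on ({-r<..<r} \<times> {a..b}) (\<lambda>(e, t). lagrangian' e t)"
proof -
  let ?D = "{-r<..<r} \<times> {a..b}"
  have lift: "continuous_on ?D (\<lambda>z. F (snd z))" if "continuous_on {a..b} F"
    for F :: "real \<Rightarrow> 'z::topological_space"
    by (rule continuous_on_compose2[OF that]) (auto intro!: continuous_intros)
  have lift': "continuous_on ?D (\<lambda>z. F (fst z))" if "continuous_on {-r<..<r} F"
    for F :: "real \<Rightarrow> 'z::topological_space"
    by (rule continuous_on_compose2[OF that]) (auto intro!: continuous_intros)
  note cs = lift[OF y_cont] lift[OF p_cont] lift[OF p'_cont] lift[OF Dy_cont] lift[OF l_cont]
    lift'[OF c_cont] lift'[OF c'_cont]
  have Yz: "continuous_on ?D (\<lambda>z. varied_state (fst z) (snd z))"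
    unfolding varied_state_def by (intro continuous_intros cs)
  have "continuous_on ?D (\<lambda>z. h (varied_state (fst z) (snd z)) (snd z))"
  proof -
    have "continuous_on ?D (\<lambda>z. (varied_state (fst z) (snd z), snd z))"
      by (intro continuous_intros Yz)
    from continuous_on_compose2[OF h_cont this] show ?thesis by (simp add: image_subset_iff mem_Times_iff)
  qed
  then show "continuous_on ?D (\<lambda>(e, t). lagrangian e t)"
    unfolding lagrangian_def split_beta by (intro continuous_intros cs)
  have "continuous_on ?D (\<lambda>z. (varied_state (fst z) (snd z), snd z, p (snd z) *\<^sub>R c' (fst z)))"
    by (intro continuous_intros cs Yz)
  from continuous_on_compose2[OF h'_cont this]
  have "continuous_on ?D (\<lambda>z. h' (varied_state (fst z) (snd z)) (snd z) (p (snd z) *\<^sub>R c' (fst z)))"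
    by (simp add: image_subset_iff mem_Times_iff)
  then show "continuous_on ?D (\<lambda>(e, t). lagrangian' e t)"
    unfolding lagrangian'_def split_beta by (intro continuous_intros cs)
qed

lemma lagrangian_deriv:
  assumes "e \<in> {-r<..<r}"
  shows "((\<lambda>e. lagrangian e t) has_real_derivative lagrangian' e t) (at e)"
proof -
  have "((\<lambda>e. varied_state e t) has_vector_derivative p t *\<^sub>R c' e) (at e)"
    unfolding varied_state_def using has_vector_derivative_add[OF has_vector_derivative_const
        bounded_linear.has_vector_derivative[OF bounded_linear_scaleR_right c_deriv[OF assms]]] by simp
  from vector_derivative_diff_chain_within[OF this has_derivative_at_withinI[OF h_deriv]]
  have "((\<lambda>e. h (varied_state e t) t) has_vector_derivative h' (varied_state e t) t (p t *\<^sub>R c' e)) (at e)"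
    by (simp add: o_def)
  moreover have "((\<lambda>e. Dy t + p' t *\<^sub>R c e) has_vector_derivative p' t *\<^sub>R c' e) (at e)"
    using has_vector_derivative_add[OF has_vector_derivative_const
        bounded_linear.has_vector_derivative[OF bounded_linear_scaleR_right c_deriv[OF assms]]] by simp
  from bounded_linear.has_vector_derivative[OF bounded_linear_inner_right this]
  have "((\<lambda>e. l t \<bullet> (Dy t + p' t *\<^sub>R c e)) has_vector_derivative l t \<bullet> (p' t *\<^sub>R c' e)) (at e)" .
  ultimately show ?thesis
    unfolding lagrangian_def lagrangian'_def has_real_derivative_iff_has_vector_derivative
    by (rule has_vector_derivative_diff)
qed

lemma lagrangian_0:
  "lagrangian 0 s = h (y s) s - l s \<bullet> Dy s"
  "lagrangian' 0 = (\<lambda>t. h' (y t) t (c' 0) * p t - (l t \<bullet> c' 0) * p' t)"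
  by (auto simp: lagrangian_def lagrangian'_def varied_state_def c_0 h'_scaleR)

lemma integral_lagrangian:
  assumes "{a'..b'} \<subseteq> {a..b}" "a' < b'"
  shows "integral {a'..b'} (\<lambda>t. h (varied_state e t) t - l t \<bullet> vector_derivative (varied_state e) (at t within {a'..b'}))
    = integral {a'..b'} (lagrangian e)"
proof (rule integral_cong)
  fix t assume t: "t \<in> {a'..b'}"
  then have "(varied_state e has_vector_derivative Dy t + p' t *\<^sub>R c e) (at t within {a'..b'})"
    using has_vector_derivative_within_subset[OF varied_state_deriv assms(1)] assms(1) by auto
  with t assms(2) show "h (varied_state e t) t - l t \<bullet> vector_derivative (varied_state e) (at t within {a'..b'})
      = lagrangian e t"
    by (simp add: lagrangian_def vector_derivative_within_closed_interval)
qed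

lemma first_variation_right_end:
  assumes s: "a < s" "s < b" and T: "(T has_real_derivative T') (at 0)" "T 0 = s"
  shows "((\<lambda>e. integral {a..T e} (\<lambda>t. h (varied_state e t) t -
        l t \<bullet> vector_derivative (varied_state e) (at t within {a..T e}))) has_real_derivative
      (h (y s) s - l s \<bullet> Dy s) * T' +
      integral {a..s} (\<lambda>t. h' (y t) t (c' 0) * p t - (l t \<bullet> c' 0) * p' t)) (at 0)"
proof -
  have "\<forall>\<^sub>F e in nhds 0. a < T e \<and> T e < b"
    using endpoint_eventually_inside[OF T(1)] s T(2) by simp
  then have ev: "\<forall>\<^sub>F e in nhds 0. integral {a..T e} (\<lambda>t. h (varied_state e t) t -
        l t \<bullet> vector_derivative (varied_state e) (at t within {a..T e})) = integral {a..T e} (lagrangian e)"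
    by eventually_elim (simp add: integral_lagrangian)
  have "((\<lambda>e. integral {a..T e} (lagrangian e)) has_real_derivative
      lagrangian 0 s * T' + integral {a..s} (lagrangian' 0)) (at 0)"
    by (rule moving_endpoint_derivative[OF r_pos s lagrangian_cont lagrangian_deriv T])
  then show ?thesis
    unfolding lagrangian_0 by (rule DERIV_cong_ev[OF refl ev refl, THEN iffD2])
qed

lemma first_variation_left_end:
  assumes s: "a < s" "s < b" and T: "(T has_real_derivative T') (at 0)" "T 0 = s"
  shows "((\<lambda>e. integral {T e..b} (\<lambda>t. h (varied_state e t) t -
        l t \<bullet> vector_derivative (varied_state e) (at t within {T e..b}))) has_real_derivative
      integral {s..b} (\<lambda>t. h' (y t) t (c' 0) * p t - (l t \<bullet> c' 0) * p' t) -
      (h (y s) s - l s \<bullet> Dy s) * T') (at 0)"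
proof -
  have "\<forall>\<^sub>F e in nhds 0. a < T e \<and> T e < b"
    using endpoint_eventually_inside[OF T(1)] s T(2) by simp
  then have ev: "\<forall>\<^sub>F e in nhds 0. integral {T e..b} (\<lambda>t. h (varied_state e t) t -
        l t \<bullet> vector_derivative (varied_state e) (at t within {T e..b})) = integral {T e..b} (lagrangian e)"
    by eventually_elim (simp add: integral_lagrangian)
  have "((\<lambda>e. integral {T e..b} (lagrangian e)) has_real_derivative
      integral {s..b} (lagrangian' 0) - lagrangian 0 s * T') (at 0)"
    by (rule moving_left_endpoint_derivative[OF r_pos s lagrangian_cont lagrangian_deriv T])
  then show ?thesis
    unfolding lagrangian_0 by (rule DERIV_cong_ev[OF refl ev refl, THEN iffD2])
qed

end

section \<open>Matching the two arcs at the interface\<close>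

lemma interface_chain_rule:
  fixes g :: "'a::euclidean_space \<Rightarrow> real \<Rightarrow> real" and z :: "real \<Rightarrow> 'a"
  assumes g: "cont_diff (\<lambda>(x, t). g x t)"
    and m: "GDERIV (\<lambda>y. g y \<tau>) \<xi> :> m"
    and mu: "((\<lambda>s. g \<xi> s) has_real_derivative \<mu>) (at \<tau>)"
    and z: "(z has_vector_derivative w) (at 0)" "z 0 = \<xi>"
    and T: "(T has_real_derivative \<sigma>) (at 0)" "T 0 = \<tau>"
  shows "((\<lambda>e. g (z e) (T e)) has_real_derivative m \<bullet> w + \<mu> * \<sigma>) (at 0)"
proof -
  obtain g' where "\<And>z. ((\<lambda>(x, t). g x t) has_derivative blinfun_apply (g' z)) (at z)"
    using g unfolding cont_diff_def by blast
  then have g': "((\<lambda>(x, t). g x t) has_derivative blinfun_apply (g' (\<xi>, \<tau>))) (at (\<xi>, \<tau>))" .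
  let ?G = "blinfun_apply (g' (\<xi>, \<tau>))"
  have "((\<lambda>y. g y \<tau>) has_derivative (\<lambda>v. ?G (v, 0))) (at \<xi>)"
    using has_derivative_compose[OF has_derivative_Pair[OF has_derivative_ident has_derivative_const] g']
    by simp
  moreover have "((\<lambda>y. g y \<tau>) has_derivative (\<lambda>v. m \<bullet> v)) (at \<xi>)"
    using m unfolding gderiv_def by (simp add: inner_commute)
  ultimately have "(\<lambda>v. ?G (v, 0)) = (\<lambda>v. m \<bullet> v)"
    by (rule has_derivative_unique)
  then have Gx: "?G (v, 0) = m \<bullet> v" for v by (rule fun_cong)
  have "((\<lambda>s. g \<xi> s) has_derivative (\<lambda>s. ?G (0, s))) (at \<tau>)"
    using has_derivative_compose[OF has_derivative_Pair[OF has_derivative_const has_derivative_ident] g']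
    by simp
  moreover have "((\<lambda>s. g \<xi> s) has_derivative (*) \<mu>) (at \<tau>)"
    using mu by (simp add: has_field_derivative_def)
  ultimately have "(\<lambda>s. ?G (0, s)) = (*) \<mu>"
    by (rule has_derivative_unique)
  then have Gt: "?G (0, s) = \<mu> * s" for s by (rule fun_cong)
  have "?G (w, \<sigma>) = ?G (w, 0) + ?G (0, \<sigma>)"
    by (simp flip: blinfun.add_right)
  then have G: "?G (w, \<sigma>) = m \<bullet> w + \<mu> * \<sigma>" by (simp add: Gx Gt)
  have curve: "((\<lambda>e. (z e, T e)) has_vector_derivative (w, \<sigma>)) (at 0)"
    using z(1) T(1) unfolding has_real_derivative_iff_has_vector_derivative
    by (rule has_vector_derivative_Pair)
  have "((\<lambda>(x, t). g x t) has_derivative ?G) (at (z 0, T 0) within range (\<lambda>e. (z e, T e)))"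
    unfolding z(2) T(2) by (rule has_derivative_at_withinI[OF g'])
  from vector_derivative_diff_chain_within[OF curve this] show ?thesis
    by (simp add: o_def G has_real_derivative_iff_has_vector_derivative)
qed

lemma has_vector_derivative_unique_on_open:
  assumes x: "(x has_vector_derivative v) (at t within S)" and y: "(y has_vector_derivative w) (at t within R)"
    and U: "open U" "t \<in> U" "U \<subseteq> S" "U \<subseteq> R" and eq: "\<And>s. s \<in> U \<Longrightarrow> x s = y s"
  shows "v = w"
proof -
  have "(x has_vector_derivative v) (at t)" "(y has_vector_derivative w) (at t)"
    using has_vector_derivative_within_subset[OF x U(3)] has_vector_derivative_within_subset[OF y U(4)]
    by (simp_all add: at_within_open[OF U(2,1)])
  moreover from this(1) have "(y has_vector_derivative v) (at t)"
    by (rule has_vector_derivative_transform_within_open[OF _ U(1,2) eq])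
  ultimately show ?thesis by (meson vector_derivative_unique_at)
qed

lemma continuous_eq_at_ends:
  fixes F G :: "real \<Rightarrow> 'a::real_normed_vector"
  assumes ab: "a < b" and FG: "continuous_on {a..b} F" "continuous_on {a..b} G"
    and eq: "\<And>t. t \<in> {a<..<b} \<Longrightarrow> F t = G t" and t: "t \<in> {a..b}"
  shows "F t = G t"
proof -
  have "F t - G t = 0"
  proof (rule continuous_constant_on_closure[where S = "{a<..<b}"])
    show "continuous_on (closure {a<..<b}) (\<lambda>t. F t - G t)"
      using FG ab by (simp add: closure_greaterThanLessThan continuous_on_diff)
  qed (use eq t ab in \<open>auto simp: closure_greaterThanLessThan\<close>)
  then show ?thesis by simp
qed

text \<open>
  With \<open>z e\<close> the gap between the two arcs at the perturbed switching time and \<open>k e\<close> the value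
  there of the weight on the second arc, \<open>c\<close> is the amplitude that closes the gap.  As the gap is
  zero at \<open>e = 0\<close>, only its velocity enters the velocity of \<open>c\<close>.
\<close>

lemma matching_correction:
  fixes z z' :: "real \<Rightarrow> 'a::real_normed_vector" and k k' :: "real \<Rightarrow> real"
  assumes z: "\<And>e. e \<in> I \<Longrightarrow> (z has_vector_derivative z' e) (at e)" and z': "continuous_on I z'"
    and k: "\<And>e. e \<in> I \<Longrightarrow> (k has_real_derivative k' e) (at e)" and k': "continuous_on I k'"
    and k_nz: "\<And>e. e \<in> I \<Longrightarrow> k e \<noteq> 0" and at_0: "z 0 = 0" "k 0 = 1"
  obtains c c' where "\<And>e. e \<in> I \<Longrightarrow> (c has_vector_derivative c' e) (at e)" "continuous_on I c'"
    "c 0 = 0" "c' 0 = z' 0" "\<And>e. e \<in> I \<Longrightarrow> k e *\<^sub>R c e = z e"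
proof
  let ?c = "\<lambda>e. inverse (k e) *\<^sub>R z e"
  let ?c' = "\<lambda>e. inverse (k e) *\<^sub>R z' e + (- (inverse (k e) * k' e * inverse (k e))) *\<^sub>R z e"
  show "(?c has_vector_derivative ?c' e) (at e)" if "e \<in> I" for e
    by (rule has_vector_derivative_scaleR[OF DERIV_inverse'[OF k[OF that] k_nz[OF that]] z[OF that]])
  have "continuous_on I z"
    by (rule continuous_on_vector_derivative) (rule has_vector_derivative_at_within, rule z)
  moreover have "continuous_on I k"
    by (rule DERIV_continuous_on) (rule has_field_derivative_at_within, rule k)
  ultimately show "continuous_on I ?c'"
    using k_nz by (intro continuous_intros z' k') auto
  show "?c 0 = 0" "?c' 0 = z' 0" using at_0 by auto
  show "k e *\<^sub>R ?c e = z e" if "e \<in> I" for e using k_nz[OF that] by simp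
qed

lemma C1_onE:
  assumes "C1_on S F"
  obtains D where "\<And>t. t \<in> S \<Longrightarrow> (F has_vector_derivative D t) (at t within S)" "continuous_on S D"
  using assms unfolding C1_on_def by blast

lemma C1_family_C0_const:
  assumes "continuous_on S F"
  shows "C1_family_C0 I S (\<lambda>_. F)"
  using C1_family_C0_scaled[OF assms, of "\<lambda>_. 0" I "\<lambda>_. 0" "\<lambda>_. 0"] by simp

section \<open>The stationarity conditions at the switch\<close>

context two_mode_problem
begin

text \<open>
  The switching time is moved with velocity \<open>\<sigma>\<close>, the first arc is varied at the switch by \<open>v\<close>, and
  the second arc follows: at the switch its variation is \<open>\<sigma> *\<^sub>R F1 + v - \<sigma> *\<^sub>R F2\<close>, because the switching
  point moves with velocity \<open>\<sigma> *\<^sub>R F1 + v\<close>.  Stationarity holds for every weight exponent \<open>N\<close>, and the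
  limit \<open>N \<rightarrow> \<infinity>\<close> removes the integrals.  The stage costs enter because the state equation reduces
  the integrand of the augmented cost to \<open>L1\<close> and \<open>L2\<close> at the switch.
\<close>

lemma switching_stationarity:
  assumes adm: "admissible x u \<tau>" and cos: "costates x u \<tau> lam1 lam2"
    and m: "GDERIV (\<lambda>y. g y \<tau>) (x \<tau>) :> m"
    and mu: "((\<lambda>s. g (x \<tau>) s) has_real_derivative \<mu>) (at \<tau>)"
  defines "F1 \<equiv> f1 (x \<tau>) (ctrl1 u \<tau> \<tau>) \<tau>" and "F2 \<equiv> f2 (x \<tau>) (ctrl2 u \<tau> \<tau>) \<tau>"
  obtains \<nu> where "\<And>\<sigma> v. \<nu> * (m \<bullet> (\<sigma> *\<^sub>R F1 + v) + \<mu> * \<sigma>)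
      + (L1 (x \<tau>) (ctrl1 u \<tau> \<tau>) \<tau> - L2 (x \<tau>) (ctrl2 u \<tau> \<tau>) \<tau>) * \<sigma>
      - lam1 \<tau> \<bullet> v + lam2 \<tau> \<bullet> (\<sigma> *\<^sub>R F1 + v - \<sigma> *\<^sub>R F2) = 0"
proof -
  have tau: "t0 < \<tau>" "\<tau> < tf" and x_t0: "x t0 = x0"
    using adm unfolding admissible_def by auto
  have x_f1: "(x has_vector_derivative f1 (x t) (u t) t) (at t within {t0..tf})" if "t \<in> {t0<..<\<tau>}" for t
    using adm that unfolding admissible_def by (fastforce simp: less_imp_le)
  have x_f2: "(x has_vector_derivative f2 (x t) (u t) t) (at t within {t0..tf})" if "t \<in> {\<tau><..<tf}" for t
    using adm that unfolding admissible_def by (fastforce simp: less_imp_le)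
  obtain \<nu> d x1 x2 u1 u2 m1 m2 where d: "d > 0"
    and C1x: "C1_on {t0..\<tau> + d} x1" "C1_on {\<tau> - d..tf} x2"
    and u_cont: "continuous_on {t0..\<tau> + d} u1" "continuous_on {\<tau> - d..tf} u2"
    and C1m: "C1_on {t0..\<tau> + d} m1" "C1_on {\<tau> - d..tf} m2"
    and ext1': "\<forall>t\<in>{t0..\<tau>}. x1 t = x t \<and> u1 t = ctrl1 u \<tau> t \<and> m1 t = lam1 t"
    and ext2': "\<forall>t\<in>{\<tau>..tf}. x2 t = x t \<and> u2 t = ctrl2 u \<tau> t \<and> m2 t = lam2 t"
    and stationary': "\<forall>r X1 X2 U1 U2 T. variation d x1 x2 u1 u2 \<tau> r X1 X2 U1 U2 T \<longrightarrow>
           ((\<lambda>e. augmented_cost \<nu> m1 m2 (X1 e) (X2 e) (U1 e) (U2 e) (T e))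
              has_real_derivative 0) (at 0)"
    using cos unfolding costates_def by (elim conjE exE) (rule that)
  note ext1 = ext1'[rule_format] and ext2 = ext2'[rule_format] and stationary = stationary'[rule_format]
  obtain D1 where D1: "\<And>t. t \<in> {t0..\<tau> + d} \<Longrightarrow> (x1 has_vector_derivative D1 t) (at t within {t0..\<tau> + d})"
    and D1_cont: "continuous_on {t0..\<tau> + d} D1" using C1x(1) by (rule C1_onE) (rule that)
  obtain D2 where D2: "\<And>t. t \<in> {\<tau> - d..tf} \<Longrightarrow> (x2 has_vector_derivative D2 t) (at t within {\<tau> - d..tf})"
    and D2_cont: "continuous_on {\<tau> - d..tf} D2" using C1x(2) by (rule C1_onE) (rule that)
  obtain E1 where E1: "\<And>t. t \<in> {t0..\<tau> + d} \<Longrightarrow> (m1 has_vector_derivative E1 t) (at t within {t0..\<tau> + d})"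
    and E1_cont: "continuous_on {t0..\<tau> + d} E1" using C1m(1) by (rule C1_onE) (rule that)
  obtain E2 where E2: "\<And>t. t \<in> {\<tau> - d..tf} \<Longrightarrow> (m2 has_vector_derivative E2 t) (at t within {\<tau> - d..tf})"
    and E2_cont: "continuous_on {\<tau> - d..tf} E2" using C1m(2) by (rule C1_onE) (rule that)
  have x1_cont: "continuous_on {t0..\<tau> + d} x1" using D1 by (rule continuous_on_vector_derivative)
  have x2_cont: "continuous_on {\<tau> - d..tf} x2" using D2 by (rule continuous_on_vector_derivative)
  have m1_cont: "continuous_on {t0..\<tau> + d} m1" using E1 by (rule continuous_on_vector_derivative)
  have m2_cont: "continuous_on {\<tau> - d..tf} m2" using E2 by (rule continuous_on_vector_derivative)
  define h1 where "h1 y t = L1 y (u1 t) t + m1 t \<bullet> f1 y (u1 t) t" for y t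
  define h2 where "h2 y t = L2 y (u2 t) t + m2 t \<bullet> f2 y (u2 t) t" for y t
  obtain h1' where h1': "\<And>y t. ((\<lambda>y. h1 y t) has_derivative h1' y t) (at y)"
    "continuous_on (UNIV \<times> {t0..\<tau> + d} \<times> UNIV) (\<lambda>(y, t, v). h1' y t v)"
    "continuous_on (UNIV \<times> {t0..\<tau> + d}) (\<lambda>(y, t). h1 y t)"
    by (rule state_derivative_of_hamiltonian[OF cont_diff_L1 cont_diff_f1 u_cont(1) m1_cont])
      (rule that, unfold h1_def)
  obtain h2' where h2': "\<And>y t. ((\<lambda>y. h2 y t) has_derivative h2' y t) (at y)"
    "continuous_on (UNIV \<times> {\<tau> - d..tf} \<times> UNIV) (\<lambda>(y, t, v). h2' y t v)"
    "continuous_on (UNIV \<times> {\<tau> - d..tf}) (\<lambda>(y, t). h2 y t)"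
    by (rule state_derivative_of_hamiltonian[OF cont_diff_L2 cont_diff_f2 u_cont(2) m2_cont])
      (rule that, unfold h2_def)
  interpret A1: mode_arc t0 "\<tau> + d" h1 h1' x1 D1 m1 E1
    by unfold_locales (use h1' D1 D1_cont E1 E1_cont in auto)
  interpret A2: mode_arc "\<tau> - d" tf h2 h2' x2 D2 m2 E2
    by unfold_locales (use h2' D2 D2_cont E2 E2_cont in auto)

  have at_tau: "x1 \<tau> = x \<tau>" "u1 \<tau> = ctrl1 u \<tau> \<tau>" "m1 \<tau> = lam1 \<tau>"
    "x2 \<tau> = x \<tau>" "u2 \<tau> = ctrl2 u \<tau> \<tau>" "m2 \<tau> = lam2 \<tau>"
    using ext1[of \<tau>] ext2[of \<tau>] tau by auto
  have f1_cont: "continuous_on UNIV (\<lambda>(x, u, t). f1 x u t)"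
    by (rule cont_diff_continuous_on[OF cont_diff_f1])
  have f2_cont: "continuous_on UNIV (\<lambda>(x, u, t). f2 x u t)"
    by (rule cont_diff_continuous_on[OF cont_diff_f2])
  \<comment> \<open>The state equation is only assumed away from the switch; continuity extends it there.\<close>
  have D1_tau: "D1 \<tau> = F1"
  proof -
    have sub: "{t0..\<tau>} \<subseteq> {t0..\<tau> + d}" using d by auto
    have "continuous_on {t0..\<tau>} (\<lambda>t. (x1 t, u1 t, t))"
      by (intro continuous_intros continuous_on_subset[OF _ sub] x1_cont u_cont)
    from continuous_on_compose2[OF f1_cont this]
    have "continuous_on {t0..\<tau>} (\<lambda>t. f1 (x1 t) (u1 t) t)" by simp
    moreover have "D1 t = f1 (x1 t) (u1 t) t" if t: "t \<in> {t0<..<\<tau>}" for t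
    proof -
      have F: "(x has_vector_derivative f1 (x1 t) (u1 t) t) (at t within {t0..tf})"
        using x_f1[OF t] ext1[of t] t by (simp add: ctrl1_def)
      have D: "(x1 has_vector_derivative D1 t) (at t within {t0..\<tau> + d})"
        using D1[of t] t d by simp
      show ?thesis
        by (rule has_vector_derivative_unique_on_open[OF D F, where U = "{t0<..<\<tau>}"])
          (use t tau d ext1 in auto)
    qed
    ultimately show ?thesis
      using continuous_eq_at_ends[OF tau(1) continuous_on_subset[OF D1_cont sub], of _ \<tau>] tau
      by (simp add: F1_def at_tau)
  qed
  have D2_tau: "D2 \<tau> = F2"
  proof -
    have sub: "{\<tau>..tf} \<subseteq> {\<tau> - d..tf}" using d by auto
    have "continuous_on {\<tau>..tf} (\<lambda>t. (x2 t, u2 t, t))"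
      by (intro continuous_intros continuous_on_subset[OF _ sub] x2_cont u_cont)
    from continuous_on_compose2[OF f2_cont this]
    have "continuous_on {\<tau>..tf} (\<lambda>t. f2 (x2 t) (u2 t) t)" by simp
    moreover have "D2 t = f2 (x2 t) (u2 t) t" if t: "t \<in> {\<tau><..<tf}" for t
    proof -
      have F: "(x has_vector_derivative f2 (x2 t) (u2 t) t) (at t within {t0..tf})"
        using x_f2[OF t] ext2[of t] t by (simp add: ctrl2_def)
      have D: "(x2 has_vector_derivative D2 t) (at t within {\<tau> - d..tf})"
        using D2[of t] t d by simp
      show ?thesis
        by (rule has_vector_derivative_unique_on_open[OF D F, where U = "{\<tau><..<tf}"])
          (use t tau d ext2 in auto)
    qed
    ultimately show ?thesis
      using continuous_eq_at_ends[OF tau(2) continuous_on_subset[OF D2_cont sub], of _ \<tau>] tau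
      by (simp add: F2_def at_tau)
  qed

  have "\<nu> * (m \<bullet> (\<sigma> *\<^sub>R F1 + v) + \<mu> * \<sigma>)
      + (L1 (x \<tau>) (ctrl1 u \<tau> \<tau>) \<tau> - L2 (x \<tau>) (ctrl2 u \<tau> \<tau>) \<tau>) * \<sigma>
      - lam1 \<tau> \<bullet> v + lam2 \<tau> \<bullet> (\<sigma> *\<^sub>R F1 + v - \<sigma> *\<^sub>R F2) = 0" for \<sigma> v
  proof -
    define w where "w = \<sigma> *\<^sub>R F1 + v - \<sigma> *\<^sub>R F2"
    define I1 where "I1 N = integral {t0..\<tau>} (\<lambda>t. h1' (x1 t) t v * weight t0 \<tau> N t
        - (m1 t \<bullet> v) * weight' t0 \<tau> N t)" for N
    define I2 where "I2 N = integral {\<tau>..tf} (\<lambda>t. h2' (x2 t) t w * weight tf \<tau> N t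
        - (m2 t \<bullet> w) * weight' tf \<tau> N t)" for N
    define B where "B = \<nu> * (m \<bullet> (\<sigma> *\<^sub>R F1 + v) + \<mu> * \<sigma>)
      + (L1 (x \<tau>) (ctrl1 u \<tau> \<tau>) \<tau> - L2 (x \<tau>) (ctrl2 u \<tau> \<tau>) \<tau>) * \<sigma>"
    define \<rho> where "\<rho> = min d (min (\<tau> - t0) (tf - \<tau>))"
    \<comment> \<open>Keeps the perturbed switching time within distance \<open>\<rho>\<close> of \<open>\<tau>\<close>, where all extensions are defined
        and the weight on the second arc is nonzero.\<close>
    define r where "r = \<rho> / (1 + \<bar>\<sigma>\<bar>)"
    define T where "T e = \<tau> + \<sigma> * e" for e
    have rho: "0 < \<rho>" "\<rho> \<le> d" "\<rho> \<le> \<tau> - t0" "\<rho> \<le> tf - \<tau>" using d tau by (auto simp: \<rho>_def)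
    have r: "0 < r" using rho by (simp add: r_def)
    let ?I = "{-r<..<r}"
    have T_near: "\<bar>\<sigma> * e\<bar> < \<rho>" if "e \<in> ?I" for e
    proof -
      have "\<bar>\<sigma> * e\<bar> \<le> \<bar>\<sigma>\<bar> * r" using that by (auto simp: abs_mult intro!: mult_left_mono)
      also have "\<dots> < (1 + \<bar>\<sigma>\<bar>) * r" using r by (simp add: algebra_simps)
      also have "\<dots> = \<rho>" by (simp add: r_def)
      finally show ?thesis .
    qed
    have T_in: "T e \<in> {t0<..<\<tau> + d}" "T e \<in> {\<tau> - d<..<tf}" if "e \<in> ?I" for e
      using T_near[OF that] rho unfolding T_def by auto
    have T_deriv: "(T has_real_derivative \<sigma>) (at e)" for e
      unfolding T_def[abs_def] by (auto intro!: derivative_eq_intros)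
    have T_0: "T 0 = \<tau>" by (simp add: T_def)
    have T_cont: "continuous_on ?I T" unfolding T_def[abs_def] by (intro continuous_intros)
    have zero_in: "0 \<in> ?I" using r by simp
    have x1T: "((\<lambda>e. x1 (T e)) has_vector_derivative \<sigma> *\<^sub>R D1 (T e)) (at e)" if "e \<in> ?I" for e
    proof -
      have "(x1 has_vector_derivative D1 (T e)) (at (T e) within {t0..\<tau> + d})"
        using D1[of "T e"] T_in(1)[OF that] by simp
      then have "(x1 has_vector_derivative D1 (T e)) (at (T e))"
        using at_within_interior[of "T e" "{t0..\<tau> + d}"] T_in(1)[OF that] by simp
      with T_deriv[of e] show ?thesis
        using vector_diff_chain_at[of T \<sigma> e x1 "D1 (T e)"]
        by (simp add: o_def has_real_derivative_iff_has_vector_derivative)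
    qed
    have x2T: "((\<lambda>e. x2 (T e)) has_vector_derivative \<sigma> *\<^sub>R D2 (T e)) (at e)" if "e \<in> ?I" for e
    proof -
      have "(x2 has_vector_derivative D2 (T e)) (at (T e) within {\<tau> - d..tf})"
        using D2[of "T e"] T_in(2)[OF that] by simp
      then have "(x2 has_vector_derivative D2 (T e)) (at (T e))"
        using at_within_interior[of "T e" "{\<tau> - d..tf}"] T_in(2)[OF that] by simp
      with T_deriv[of e] show ?thesis
        using vector_diff_chain_at[of T \<sigma> e x2 "D2 (T e)"]
        by (simp add: o_def has_real_derivative_iff_has_vector_derivative)
    qed
    have D1T_cont: "continuous_on ?I (\<lambda>e. D1 (T e))"
      by (rule continuous_on_compose2[OF D1_cont T_cont]) (rule image_subsetI, drule T_in(1), simp)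
    have D2T_cont: "continuous_on ?I (\<lambda>e. D2 (T e))"
      by (rule continuous_on_compose2[OF D2_cont T_cont]) (rule image_subsetI, drule T_in(2), simp)
    have weight_T: "((\<lambda>e. weight s \<tau> N (T e)) has_real_derivative weight' s \<tau> N (T e) * \<sigma>) (at e)"
      for s N e
      using DERIV_chain2[OF weight_deriv T_deriv] .
    have weight_T_cont: "continuous_on ?I (\<lambda>e. weight s \<tau> N (T e))"
      "continuous_on ?I (\<lambda>e. weight' s \<tau> N (T e))" for s N
      by (rule continuous_on_compose2[OF continuous_on_weight T_cont subset_UNIV],
          rule continuous_on_compose2[OF continuous_on_weight' T_cont subset_UNIV])

    have stationarity_N: "B + I1 N + I2 N = 0" for N
    proof -
      let ?p = "weight t0 \<tau> N" and ?q = "weight tf \<tau> N"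
      let ?p' = "weight' t0 \<tau> N" and ?q' = "weight' tf \<tau> N"
      let ?y' = "\<lambda>e. \<sigma> *\<^sub>R D1 (T e) + (?p (T e) *\<^sub>R v + (?p' (T e) * \<sigma>) *\<^sub>R (e *\<^sub>R v))"
      have ev: "((\<lambda>e. e *\<^sub>R v) has_vector_derivative v) (at e)" for e
        using bounded_linear.has_vector_derivative[OF bounded_linear_scaleR_left has_vector_derivative_id] by simp
      have y_deriv: "((\<lambda>e. x1 (T e) + ?p (T e) *\<^sub>R (e *\<^sub>R v)) has_vector_derivative ?y' e) (at e)"
        if "e \<in> ?I" for e
        by (rule has_vector_derivative_add[OF x1T[OF that] has_vector_derivative_scaleR[OF weight_T ev]])
      obtain c c' where c: "\<And>e. e \<in> ?I \<Longrightarrow> (c has_vector_derivative c' e) (at e)"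
          "continuous_on ?I c'" "c 0 = 0"
        and c'_0: "c' 0 = ?y' 0 - \<sigma> *\<^sub>R D2 (T 0)"
        and match: "\<And>e. e \<in> ?I \<Longrightarrow> ?q (T e) *\<^sub>R c e = x1 (T e) + ?p (T e) *\<^sub>R (e *\<^sub>R v) - x2 (T e)"
      proof (rule matching_correction)
        show "((\<lambda>e. x1 (T e) + ?p (T e) *\<^sub>R (e *\<^sub>R v) - x2 (T e)) has_vector_derivative
            ?y' e - \<sigma> *\<^sub>R D2 (T e)) (at e)" if "e \<in> ?I" for e
          by (rule has_vector_derivative_diff[OF y_deriv[OF that] x2T[OF that]])
        show "continuous_on ?I (\<lambda>e. ?y' e - \<sigma> *\<^sub>R D2 (T e))"
          by (intro continuous_intros D1T_cont D2T_cont weight_T_cont)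
        show "((\<lambda>e. ?q (T e)) has_real_derivative ?q' (T e) * \<sigma>) (at e)" if "e \<in> ?I" for e
          by (rule weight_T)
        show "continuous_on ?I (\<lambda>e. ?q' (T e) * \<sigma>)"
          by (intro continuous_intros weight_T_cont)
        show "?q (T e) \<noteq> 0" if "e \<in> ?I" for e
          using T_in(2)[OF that] tau by (intro weight_nonzero) auto
      qed (use tau in \<open>auto simp: T_0 at_tau weight_ends\<close>)
      have c'_0_eq: "c' 0 = w"
        using tau by (simp add: c'_0 T_0 D1_tau D2_tau w_def weight_ends)
      interpret V1: varied_arc t0 "\<tau> + d" h1 h1' x1 D1 m1 E1 ?p ?p' r "\<lambda>e. e *\<^sub>R v" "\<lambda>_. v"
        by unfold_locales (use r ev weight_deriv continuous_on_weight' in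
            \<open>auto simp: has_real_derivative_iff_has_vector_derivative\<close>)
      interpret V2: varied_arc "\<tau> - d" tf h2 h2' x2 D2 m2 E2 ?q ?q' r c c'
        by unfold_locales (use r c weight_deriv continuous_on_weight' in
            \<open>auto simp: has_real_derivative_iff_has_vector_derivative\<close>)
      have Y2_tf: "V2.varied_state e tf = x2 tf" for e
        by (simp add: V2.varied_state_def weight_ends)
      have "variation d x1 x2 u1 u2 \<tau> r V1.varied_state V2.varied_state (\<lambda>_. u1) (\<lambda>_. u2) T"
        unfolding variation_def
      proof (intro conjI ballI)
        show "C1_on ?I T" unfolding C1_on_def
          by (rule exI[of _ "\<lambda>_. \<sigma>"])
            (use T_deriv in \<open>auto simp: has_real_derivative_iff_has_vector_derivative
              intro: has_vector_derivative_at_within\<close>)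
        show "T ` ?I \<subseteq> {\<tau> - d..\<tau> + d}" by (rule image_subsetI, frule T_in(1), drule T_in(2), simp)
        show "V1.varied_state e (T e) = V2.varied_state e (T e)" if "e \<in> ?I" for e
          using match[OF that] by (simp add: V1.varied_state_def V2.varied_state_def)
        show "V1.varied_state e t0 = x0" for e
          using ext1[of t0] tau x_t0 by (simp add: V1.varied_state_def weight_ends)
      qed (use r V1.varied_state_family V2.varied_state_family u_cont Y2_tf T_0 c(3) in
          \<open>auto intro: C1_family_C0_const simp: V1.varied_state_def V2.varied_state_def\<close>)
      from stationary[OF this]
      have zero: "((\<lambda>e. augmented_cost \<nu> m1 m2 (V1.varied_state e) (V2.varied_state e) u1 u2 (T e)) has_real_derivative 0) (at 0)" .
      have aug: "augmented_cost \<nu> m1 m2 (V1.varied_state e) (V2.varied_state e) u1 u2 (T e)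
          = \<phi> (x2 tf) + \<nu> * g (V1.varied_state e (T e)) (T e)
          + integral {t0..T e} (\<lambda>t. h1 (V1.varied_state e t) t
              - m1 t \<bullet> vector_derivative (V1.varied_state e) (at t within {t0..T e}))
          + integral {T e..tf} (\<lambda>t. h2 (V2.varied_state e t) t
              - m2 t \<bullet> vector_derivative (V2.varied_state e) (at t within {T e..tf}))" for e
        by (simp add: augmented_cost_def H1_def H2_def h1_def h2_def Y2_tf)
      have g_deriv: "((\<lambda>e. g (V1.varied_state e (T e)) (T e)) has_real_derivative
          m \<bullet> (\<sigma> *\<^sub>R F1 + v) + \<mu> * \<sigma>) (at 0)"
      proof (rule interface_chain_rule[OF cont_diff_g m mu _ _ T_deriv T_0])
        show "((\<lambda>e. V1.varied_state e (T e)) has_vector_derivative \<sigma> *\<^sub>R F1 + v) (at 0)"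
          using y_deriv[OF zero_in] tau by (simp add: V1.varied_state_def T_0 D1_tau weight_ends)
        show "V1.varied_state 0 (T 0) = x \<tau>" by (simp add: V1.varied_state_def T_0 at_tau)
      qed
      have J1: "((\<lambda>e. integral {t0..T e} (\<lambda>t. h1 (V1.varied_state e t) t
              - m1 t \<bullet> vector_derivative (V1.varied_state e) (at t within {t0..T e}))) has_real_derivative
            (h1 (x1 \<tau>) \<tau> - m1 \<tau> \<bullet> D1 \<tau>) * \<sigma> + I1 N) (at 0)"
        unfolding I1_def
        by (rule V1.first_variation_right_end[OF _ _ T_deriv T_0]) (use tau d in auto)
      have J2: "((\<lambda>e. integral {T e..tf} (\<lambda>t. h2 (V2.varied_state e t) t
              - m2 t \<bullet> vector_derivative (V2.varied_state e) (at t within {T e..tf}))) has_real_derivative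
            I2 N - (h2 (x2 \<tau>) \<tau> - m2 \<tau> \<bullet> D2 \<tau>) * \<sigma>) (at 0)"
        unfolding I2_def c'_0_eq[symmetric]
        by (rule V2.first_variation_left_end[OF _ _ T_deriv T_0]) (use tau d in auto)
      have "((\<lambda>e. augmented_cost \<nu> m1 m2 (V1.varied_state e) (V2.varied_state e) u1 u2 (T e)) has_real_derivative
          0 + \<nu> * (m \<bullet> (\<sigma> *\<^sub>R F1 + v) + \<mu> * \<sigma>) + ((h1 (x1 \<tau>) \<tau> - m1 \<tau> \<bullet> D1 \<tau>) * \<sigma> + I1 N)
            + (I2 N - (h2 (x2 \<tau>) \<tau> - m2 \<tau> \<bullet> D2 \<tau>) * \<sigma>)) (at 0)"
        unfolding aug by (intro DERIV_add DERIV_const DERIV_cmult g_deriv J1 J2)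
      from DERIV_unique[OF this zero] show ?thesis
        by (simp add: B_def h1_def h2_def at_tau D1_tau D2_tau F1_def F2_def algebra_simps)
    qed
    have "I1 \<longlonglongrightarrow> - (lam1 \<tau> \<bullet> v)"
      unfolding I1_def[abs_def] at_tau(3)[symmetric] by (rule A1.limit_at_right_end) (use tau d in auto)
    moreover have "I2 \<longlonglongrightarrow> lam2 \<tau> \<bullet> w"
      unfolding I2_def[abs_def] at_tau(6)[symmetric] by (rule A2.limit_at_left_end) (use tau d in auto)
    ultimately have "(\<lambda>N. B + I1 N + I2 N) \<longlonglongrightarrow> B + - (lam1 \<tau> \<bullet> v) + lam2 \<tau> \<bullet> w"
      by (intro tendsto_intros)
    then have "B + - (lam1 \<tau> \<bullet> v) + lam2 \<tau> \<bullet> w = 0"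
      by (simp add: stationarity_N LIMSEQ_const_iff)
    then show ?thesis by (simp add: B_def w_def)
  qed
  then show ?thesis by (rule that)
qed

end

section \<open>The jump law\<close>

text \<open>
  Transversality involves the co-state after the switch.  Writing it as the average plus half
  of the jump \<open>- \<nu> *\<^sub>R m\<close> moves half of \<open>\<nu> * (m \<bullet> (F2 - F1))\<close> to the left-hand side, which turns
  \<open>m \<bullet> F1\<close> into an average too; then \<open>\<nu>\<close> can be solved for.
\<close>

lemma jump_law_algebra:
  fixes m l1 l2 F1 F2 :: "'a::real_inner"
  assumes jump: "l2 - l1 = - (\<nu> *\<^sub>R m)"
    and transversality: "\<nu> * (m \<bullet> F1 + \<mu>) = DL + l2 \<bullet> (F2 - F1)"
    and nz: "(1/2) * (m \<bullet> F1 + \<mu>) + (1/2) * (m \<bullet> F2 + \<mu>) \<noteq> 0"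
  shows "l2 - l1 = - (((DL + ((1/2) *\<^sub>R (l2 + l1)) \<bullet> (F2 - F1)) /
      ((1/2) * (m \<bullet> F1 + \<mu>) + (1/2) * (m \<bullet> F2 + \<mu>))) *\<^sub>R m)"
proof -
  have l1: "l1 = l2 + \<nu> *\<^sub>R m" using jump by (simp add: algebra_simps)
  have avg: "((1/2) *\<^sub>R (l2 + l1)) \<bullet> (F2 - F1) = l2 \<bullet> (F2 - F1) + \<nu> / 2 * (m \<bullet> (F2 - F1))"
    unfolding l1 by (simp add: inner_add_left algebra_simps)
  have "DL + ((1/2) *\<^sub>R (l2 + l1)) \<bullet> (F2 - F1)
      = \<nu> * ((1/2) * (m \<bullet> F1 + \<mu>) + (1/2) * (m \<bullet> F2 + \<mu>))"
    using transversality unfolding avg by (simp add: inner_diff_right field_simps)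
  with nz have "(DL + ((1/2) *\<^sub>R (l2 + l1)) \<bullet> (F2 - F1)) /
      ((1/2) * (m \<bullet> F1 + \<mu>) + (1/2) * (m \<bullet> F2 + \<mu>)) = \<nu>"
    by simp
  with jump show ?thesis by simp
qed

theorem mainTheorem2:
  fixes f1 f2 :: "real ^ 'n \<Rightarrow> 'u::euclidean_space \<Rightarrow> real \<Rightarrow> real ^ 'n"
    and L1 L2 :: "real ^ 'n \<Rightarrow> 'u \<Rightarrow> real \<Rightarrow> real"
    and \<phi> :: "real ^ 'n \<Rightarrow> real"
    and g :: "real ^ 'n \<Rightarrow> real \<Rightarrow> real"
    and t0 tf \<tau> \<mu> :: real
    and x0 m :: "real ^ 'n"
    and x lam1 lam2 :: "real \<Rightarrow> real ^ 'n"
    and u :: "real \<Rightarrow> 'u"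
  assumes problem: "two_mode_problem f1 f2 L1 L2 \<phi> g t0 tf"
    and optimal: "two_mode_problem.optimal f1 f2 L1 L2 \<phi> g t0 tf x0 x u \<tau>"
    and costates: "two_mode_problem.costates f1 f2 L1 L2 \<phi> g t0 tf x0 x u \<tau> lam1 lam2"
    and m: "GDERIV (\<lambda>y. g y \<tau>) (x \<tau>) :> m"
    and mu: "((\<lambda>s. g (x \<tau>) s) has_real_derivative \<mu>) (at \<tau>)"
  shows
    "let f1_tau = f1 (x \<tau>) (ctrl1 u \<tau> \<tau>) \<tau>;
         f2_tau = f2 (x \<tau>) (ctrl2 u \<tau> \<tau>) \<tau>;
         Dlam = lam2 \<tau> - lam1 \<tau>;
         avg_lam = (1/2) *\<^sub>R (lam2 \<tau> + lam1 \<tau>);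
         Df = f2_tau - f1_tau;
         DL = L2 (x \<tau>) (ctrl2 u \<tau> \<tau>) \<tau> - L1 (x \<tau>) (ctrl1 u \<tau> \<tau>) \<tau>;
         avg_mf = (1/2) * (m \<bullet> f1_tau + \<mu>) + (1/2) * (m \<bullet> f2_tau + \<mu>)
     in avg_mf \<noteq> 0 \<longrightarrow> Dlam = - (((DL + avg_lam \<bullet> Df) / avg_mf) *\<^sub>R m)"
proof -
  interpret two_mode_problem f1 f2 L1 L2 \<phi> g t0 tf x0 by (rule problem)
  have "admissible x u \<tau>" using optimal by (simp add: optimal_def)
  then obtain \<nu> where stat: "\<And>\<sigma> v. \<nu> * (m \<bullet> (\<sigma> *\<^sub>R f1 (x \<tau>) (ctrl1 u \<tau> \<tau>) \<tau> + v) + \<mu> * \<sigma>)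
      + (L1 (x \<tau>) (ctrl1 u \<tau> \<tau>) \<tau> - L2 (x \<tau>) (ctrl2 u \<tau> \<tau>) \<tau>) * \<sigma>
      - lam1 \<tau> \<bullet> v + lam2 \<tau> \<bullet> (\<sigma> *\<^sub>R f1 (x \<tau>) (ctrl1 u \<tau> \<tau>) \<tau> + v
          - \<sigma> *\<^sub>R f2 (x \<tau>) (ctrl2 u \<tau> \<tau>) \<tau>) = 0"
    by (rule switching_stationarity[OF _ costates m mu]) (rule that)
  \<comment> \<open>Switching time fixed, switching point free.\<close>
  have "(lam2 \<tau> - lam1 \<tau> + \<nu> *\<^sub>R m) \<bullet> v = 0" for v
    using stat[of 0 v] by (simp add: inner_add_left inner_diff_left)
  then have "lam2 \<tau> - lam1 \<tau> + \<nu> *\<^sub>R m = 0"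
    using inner_eq_zero_iff by blast
  then have jump: "lam2 \<tau> - lam1 \<tau> = - (\<nu> *\<^sub>R m)"
    by (simp add: eq_neg_iff_add_eq_0)
  \<comment> \<open>Switching time moved, the first arc only prolonged or shortened.\<close>
  have transversality: "\<nu> * (m \<bullet> f1 (x \<tau>) (ctrl1 u \<tau> \<tau>) \<tau> + \<mu>)
      = (L2 (x \<tau>) (ctrl2 u \<tau> \<tau>) \<tau> - L1 (x \<tau>) (ctrl1 u \<tau> \<tau>) \<tau>)
        + lam2 \<tau> \<bullet> (f2 (x \<tau>) (ctrl2 u \<tau> \<tau>) \<tau> - f1 (x \<tau>) (ctrl1 u \<tau> \<tau>) \<tau>)"
    using stat[of 1 0] by (simp add: inner_diff_right)
  show ?thesis
    unfolding Let_def by (intro impI jump_law_algebra[OF jump transversality])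
qed

end
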